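(* For $k>0$, $n\in\mathbf N$ and $\mu\in\mathcal P_n$ one has $$ p_k\, s_\mu=\sum_{\lambda\in\mathcal P_{n+k}}[\mu\prec_{r(k)}\lambda]\,(-1)^{\operatorname{ht}(\lambda/\mu)}\, s_\lambda. $$
   Context: $\mathbf N=\{0,1,2,\ldots\}$. A composition is a finitely supported sequence $\alpha=(\alpha_i)_{i\in\mathbf N}$ of natural numbers; $\mathcal C$ is the set of all compositions, and $|\alpha|=\sum_i\alpha_i$. $\mathcal P_n$ is the set of partitions of $n$: compositions $\lambda$ with $|\lambda|=n$ and $\lambda_i\ge\lambda_{i+1}$ for all $i$. Finite vectors are extended by zeros, so $\mathbf N^n\subset\mathcal C$. The Iverson bracket $[\text{condition}]$ is $1$ if the condition holds and $0$ otherwise, and in a product the factors to the right of a bracket with value $0$ are not evaluated (the product is $0$). The diagram of a partition $\lambda$ is $\{(i,j)\in\mathbf N^2: j<\lambda_i\}$; its elements are called squares, with $i$ the row coordinate. For partitions $\mu,\lambda$ with $\mu_i\le\lambda_i$ for all $i$, $\lambda/\mu$ is a skew shape, with diagram the set difference of the diagrams of $\lambda$ and $\mu$, and $|\lambda/\mu|=|\lambda|-|\mu|$. For $d\in\mathbf Z$ the diagonal $D_d$ is $\{(i,j)\in\mathbf N^2: j-i=d\}$. For $k>0$, $\mu\prec_{r(k)}\lambda$ means that $\lambda/\mu$ is a skew shape with $|\lambda/\mu|=k$ whose $k$ squares lie on $k$ consecutive diagonals $D_d,D_{d+1},\ldots,D_{d+k-1}$ (one square on each). In this case the height $\operatorname{ht}(\lambda/\mu)$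 is the row coordinate of the square on the first diagonal $D_d$ minus the row coordinate of the square on the last diagonal $D_{d+k-1}$. $\Lambda$ is the ring of symmetric functions over $\mathbf Z$ (symmetric power series of bounded degree in indeterminates $X_i$, $i\in\mathbf N$), and $p_k=\sum_{i\in\mathbf N}X_i^k\in\Lambda$. Schur functions: for $\alpha\in\mathbf N^n$ put $a_\alpha[X_{[n]}]=\sum_{\sigma\in\mathbf S_n}\operatorname{sgn}(\sigma)\prod_{i=0}^{n-1}X_{\sigma(i)}^{\alpha_i}$, let $\delta_n=(n-1,\ldots,1,0)$, and set $s_\alpha[X_{[n]}]=a_{\delta_n+\alpha}[X_{[n]}]/a_{\delta_n}[X_{[n]}]$ for $\alpha\in\mathbf N^n$ and $s_\alpha[X_{[n]}]=0$ for $\alpha\in\mathcal C\setminus\mathbf N^n$. Then $s_\alpha\in\Lambda$ is the unique symmetric function which for every $n\in\mathbf N$ becomes $s_\alpha[X_{[n]}]$ upon setting $X_i=0$ for all $i\ge n$. *)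

theory Defs
  imports "HOL-Library.Poly_Mapping" "HOL-Combinatorics.Permutations"
begin

subsection \<open>Compositions and partitions\<close>

type_synonym composition = "nat \<Rightarrow>\<^sub>0 nat"

definition csize :: "composition \<Rightarrow> nat" where
  "csize \<alpha> = (\<Sum>i\<in>Poly_Mapping.keys \<alpha>. Poly_Mapping.lookup \<alpha> i)"

definition is_partition :: "composition \<Rightarrow> bool" where
  "is_partition \<nu> \<longleftrightarrow> (\<forall>i. Poly_Mapping.lookup \<nu> (Suc i) \<le> Poly_Mapping.lookup \<nu> i)"

definition partitions :: "nat \<Rightarrow> composition set" where
  "partitions n = {\<nu>. is_partition \<nu> \<and> csize \<nu> = n}"

text \<open>The vectors in \<open>\<nat>\<^sup>n\<close>, extended by zeros.\<close>

definition vecs :: "nat \<Rightarrow> composition set" where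
  "vecs n = {\<alpha>. Poly_Mapping.keys \<alpha> \<subseteq> {..<n}}"

subsection \<open>Skew shapes and ribbons\<close>

definition diagram :: "composition \<Rightarrow> (nat \<times> nat) set" where
  "diagram \<nu> = {(i, j). j < Poly_Mapping.lookup \<nu> i}"

definition skew_shape :: "composition \<Rightarrow> composition \<Rightarrow> bool" where
  "skew_shape \<mu> \<nu> \<longleftrightarrow>
     is_partition \<mu> \<and> is_partition \<nu> \<and> (\<forall>i. Poly_Mapping.lookup \<mu> i \<le> Poly_Mapping.lookup \<nu> i)"

definition skew_diagram :: "composition \<Rightarrow> composition \<Rightarrow> (nat \<times> nat) set" where
  "skew_diagram \<mu> \<nu> = diagram \<nu> - diagram \<mu>"

text \<open>Only used for skew shapes, where \<open>csize \<mu> \<le> csize \<nu>\<close>.\<close>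

definition skew_size :: "composition \<Rightarrow> composition \<Rightarrow> nat" where
  "skew_size \<mu> \<nu> = csize \<nu> - csize \<mu>"

definition diagonal :: "int \<Rightarrow> (nat \<times> nat) set" where
  "diagonal d = {(i, j). int j - int i = d}"

text \<open>
  \<open>ribbon_from d k \<mu> \<nu>\<close>: the \<open>k\<close> squares of \<open>\<nu>/\<mu>\<close> lie on the diagonals
  \<open>d, d + 1, \<dots>, d + k - 1\<close>, one square on each.
\<close>

definition ribbon_from :: "int \<Rightarrow> nat \<Rightarrow> composition \<Rightarrow> composition \<Rightarrow> bool" where
  "ribbon_from d k \<mu> \<nu> \<longleftrightarrow>
     skew_shape \<mu> \<nu> \<and> skew_size \<mu> \<nu> = k \<and>
     skew_diagram \<mu> \<nu> \<subseteq> (\<Union>e\<in>{d..<d + int k}. diagonal e) \<and>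
     (\<forall>e\<in>{d..<d + int k}. \<exists>!s. s \<in> skew_diagram \<mu> \<nu> \<inter> diagonal e)"

definition ribbon :: "nat \<Rightarrow> composition \<Rightarrow> composition \<Rightarrow> bool" where
  "ribbon k \<mu> \<nu> \<longleftrightarrow> k > 0 \<and> (\<exists>d. ribbon_from d k \<mu> \<nu>)"

definition row_on :: "composition \<Rightarrow> composition \<Rightarrow> int \<Rightarrow> nat" where
  "row_on \<mu> \<nu> e = fst (THE s. s \<in> skew_diagram \<mu> \<nu> \<inter> diagonal e)"

text \<open>
  The height is only meaningful when \<open>\<nu>/\<mu>\<close> is a nonempty ribbon; then the first
  diagonal \<open>d\<close> is unique and the height is nonnegative, see the lemmas
  \<open>ribbon_from_unique\<close> and \<open>ht_nonneg\<close> below.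
\<close>

definition ht :: "composition \<Rightarrow> composition \<Rightarrow> int" where
  "ht \<mu> \<nu> =
     (let k = skew_size \<mu> \<nu>; d = (THE d. ribbon_from d k \<mu> \<nu>)
      in int (row_on \<mu> \<nu> d) - int (row_on \<mu> \<nu> (d + int k - 1)))"

lemma ribbon_from_le:
  assumes "ribbon_from d k \<mu> \<nu>" "ribbon_from d' k \<mu> \<nu>" "k > 0"
  shows "d' \<le> d"
proof -
  have "d \<in> {d..<d + int k}" using assms(3) by simp
  then obtain s where "s \<in> skew_diagram \<mu> \<nu>" "s \<in> diagonal d"
    using assms(1) unfolding ribbon_from_def by blast
  moreover from this(1) have "s \<in> (\<Union>e\<in>{d'..<d' + int k}. diagonal e)"
    using assms(2) unfolding ribbon_from_def by blast
  ultimately show ?thesis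
    by (auto simp: diagonal_def)
qed

lemma ribbon_from_unique:
  assumes "ribbon_from d k \<mu> \<nu>" "k > 0"
  shows "(THE d. ribbon_from d k \<mu> \<nu>) = d"
  using assms ribbon_from_le by (intro the_equality) (auto intro: antisym)

lemma partition_antimono:
  assumes "is_partition \<nu>" "i \<le> j"
  shows "Poly_Mapping.lookup \<nu> j \<le> Poly_Mapping.lookup \<nu> i"
  using assms lift_Suc_antimono_le[of "Poly_Mapping.lookup \<nu>" i j] by (auto simp: is_partition_def)

lemma ht_nonneg:
  assumes "ribbon k \<mu> \<nu>"
  shows "ht \<mu> \<nu> \<ge> 0"
proof -
  from assms obtain d where k: "k > 0" and d: "ribbon_from d k \<mu> \<nu>"
    unfolding ribbon_def by blast
  let ?S = "skew_diagram \<mu> \<nu>"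
  define e where "e = d + int k - 1"
  have sz: "skew_size \<mu> \<nu> = k" and parts: "is_partition \<mu>" "is_partition \<nu>"
    and ex1: "\<And>c. c \<in> {d..<d + int k} \<Longrightarrow> \<exists>!s. s \<in> ?S \<inter> diagonal c"
    using d unfolding ribbon_from_def skew_shape_def by blast+
  have ed: "d \<in> {d..<d + int k}" "e \<in> {d..<d + int k}"
    using k by (auto simp: e_def)
  obtain i j where s: "(i, j) \<in> ?S \<inter> diagonal d" using ex1[OF ed(1)] by fastforce
  obtain i' j' where s': "(i', j') \<in> ?S \<inter> diagonal e" using ex1[OF ed(2)] by fastforce
  have row: "row_on \<mu> \<nu> d = i" "row_on \<mu> \<nu> e = i'"
    unfolding row_on_def
    using the1_equality[OF ex1[OF ed(1)] s] the1_equality[OF ex1[OF ed(2)] s'] by simp_all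
  have "\<not> i < i'"
  proof
    assume "i < i'"
    with s s' k have "Suc j \<le> j'" by (auto simp: diagonal_def e_def)
    with s' have "Suc j < Poly_Mapping.lookup \<nu> i'" by (auto simp: skew_diagram_def diagram_def)
    also have "\<dots> \<le> Poly_Mapping.lookup \<nu> (Suc i)"
      using \<open>i < i'\<close> parts(2) by (intro partition_antimono) auto
    finally have "Suc j < Poly_Mapping.lookup \<nu> (Suc i)" .
    moreover have "\<not> Suc j < Poly_Mapping.lookup \<mu> (Suc i)"
      using s partition_antimono[OF parts(1), of i "Suc i"]
      by (auto simp: skew_diagram_def diagram_def)
    ultimately have "(Suc i, Suc j) \<in> ?S \<inter> diagonal d"
      using s by (auto simp: skew_diagram_def diagram_def diagonal_def)
    with s ex1[OF ed(1)] have "(Suc i, Suc j) = (i, j)" by (metis (no_types, lifting))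
    then show False by simp
  qed
  moreover have "ht \<mu> \<nu> = int i - int i'"
    unfolding ht_def Let_def sz ribbon_from_unique[OF d k] row(1)
    using row(2) by (simp only: e_def)
  ultimately show ?thesis by simp
qed

subsection \<open>Power series in the indeterminates \<open>X\<^sub>i\<close>, \<open>i \<in> \<nat>\<close>\<close>

text \<open>A composition \<open>m\<close> also stands for the monomial \<open>\<Prod>i. X\<^sub>i ^ m\<^sub>i\<close>.\<close>

typedef mseries = "UNIV :: (composition \<Rightarrow> int) set"
  morphisms mcoeff Abs_mseries ..

setup_lifting type_definition_mseries

lemma mseries_eqI: "(\<And>m. mcoeff f m = mcoeff g m) \<Longrightarrow> f = g"
  by transfer auto

lemma lookup_le_csize: "Poly_Mapping.lookup m i \<le> csize m"
proof (cases "i \<in> Poly_Mapping.keys m")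
  case True
  then show ?thesis unfolding csize_def by (intro member_le_sum) auto
qed (simp add: in_keys_iff)

lemma finite_composition_pairs: "finite {(a, b). a + b = (m :: composition)}"
proof -
  define D where "D = {a :: composition. \<forall>i. Poly_Mapping.lookup a i \<le> Poly_Mapping.lookup m i}"
  define F where "F = {f. \<forall>i. (i \<in> Poly_Mapping.keys m \<longrightarrow> f i \<in> {..csize m}) \<and>
                              (i \<notin> Poly_Mapping.keys m \<longrightarrow> f i = (0::nat))}"
  have "finite F"
    unfolding F_def by (rule finite_set_of_finite_funs) auto
  moreover have "Poly_Mapping.lookup a \<in> F" if "a \<in> D" for a
  proof -
    have le: "Poly_Mapping.lookup a i \<le> Poly_Mapping.lookup m i" for i
      using that unfolding D_def by blast
    have "Poly_Mapping.lookup a i \<in> {..csize m}" for i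
      using order_trans[OF le lookup_le_csize] by (simp only: atMost_iff)
    moreover have "Poly_Mapping.lookup a i = 0" if "i \<notin> Poly_Mapping.keys m" for i
      using le[of i] that by (simp add: in_keys_iff)
    ultimately show ?thesis unfolding F_def by blast
  qed
  ultimately have "finite (Poly_Mapping.lookup ` D)"
    by (meson finite_subset image_subsetI)
  moreover have "inj_on Poly_Mapping.lookup D"
    by (rule inj_onI) (simp add: poly_mapping_eqI)
  ultimately have fin: "finite D"
    by (rule finite_imageD)
  have "{(a, b). a + b = m} \<subseteq> D \<times> D"
    unfolding D_def by (auto simp: lookup_add)
  then show ?thesis
    by (rule finite_subset) (intro finite_cartesian_product fin)
qed

instantiation mseries :: comm_ring_1
begin

lift_definition zero_mseries :: mseries is "\<lambda>m. 0" .
lift_definition one_mseries :: mseries is "\<lambda>m. if m = 0 then 1 else 0" .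
lift_definition plus_mseries :: "mseries \<Rightarrow> mseries \<Rightarrow> mseries" is "\<lambda>f g m. f m + g m" .
lift_definition minus_mseries :: "mseries \<Rightarrow> mseries \<Rightarrow> mseries" is "\<lambda>f g m. f m - g m" .
lift_definition uminus_mseries :: "mseries \<Rightarrow> mseries" is "\<lambda>f m. - f m" .
lift_definition times_mseries :: "mseries \<Rightarrow> mseries \<Rightarrow> mseries" is
  "\<lambda>f g m. \<Sum>(a, b) | a + b = m. f a * g b" .

instance
proof
  fix f g h :: mseries
  show "f * g * h = f * (g * h)"
  proof (transfer, rule ext)
    fix f g h :: "composition \<Rightarrow> int" and m :: composition
    let ?P = "\<lambda>m :: composition. {(a, b). a + b = m}"
    have "(\<Sum>(c, z)\<in>?P m. (\<Sum>(x, y)\<in>?P c. f x * g y) * h z) =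
          (\<Sum>p\<in>?P m. \<Sum>q\<in>?P (fst p). f (fst q) * g (snd q) * h (snd p))"
      by (simp add: case_prod_unfold sum_distrib_right)
    also have "\<dots> = (\<Sum>(p, q)\<in>(SIGMA p:?P m. ?P (fst p)). f (fst q) * g (snd q) * h (snd p))"
      by (intro sum.Sigma) (use finite_composition_pairs in auto)
    also have "\<dots> = (\<Sum>(p, q)\<in>(SIGMA p:?P m. ?P (snd p)). f (fst p) * g (fst q) * h (snd q))"
      by (rule sum.reindex_bij_witness[where
            i = "\<lambda>((x, _), (y, z)). ((x + y, z), (x, y))" and
            j = "\<lambda>((_, z), (x, y)). ((x, y + z), (y, z))"])
         (auto simp: add.assoc)
    also have "\<dots> = (\<Sum>p\<in>?P m. \<Sum>q\<in>?P (snd p). f (fst p) * g (fst q) * h (snd q))"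
      by (intro sum.Sigma[symmetric]) (use finite_composition_pairs in auto)
    also have "\<dots> = (\<Sum>(x, c)\<in>?P m. f x * (\<Sum>(y, z)\<in>?P c. g y * h z))"
      by (simp add: case_prod_unfold sum_distrib_left mult.assoc)
    finally show "(\<Sum>(c, z)\<in>?P m. (\<Sum>(x, y)\<in>?P c. f x * g y) * h z) =
                  (\<Sum>(x, c)\<in>?P m. f x * (\<Sum>(y, z)\<in>?P c. g y * h z))" .
  qed
  show "f * g = g * f"
    by (transfer, rule ext, rule sum.reindex_bij_witness[where i = prod.swap and j = prod.swap])
       (auto simp: ac_simps)
  show "1 * f = f"
  proof (transfer, rule ext)
    fix f :: "composition \<Rightarrow> int" and m :: composition
    have "(\<Sum>(a, b) | a + b = m. (if a = 0 then 1 else 0) * f b) =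
          (\<Sum>(a, b)\<in>{(0 :: composition, m)}. (if a = 0 then 1 else 0) * f b)"
      by (rule sum.mono_neutral_right) (use finite_composition_pairs in \<open>auto split: if_splits\<close>)
    then show "(\<Sum>(a, b) | a + b = m. (if a = 0 then 1 else 0) * f b) = f m" by simp
  qed
  show "(f + g) * h = f * h + g * h"
    by transfer (simp add: fun_eq_iff case_prod_unfold distrib_right sum.distrib)
  show "(0::mseries) \<noteq> 1"
    by transfer (auto simp: fun_eq_iff)
qed (transfer; simp add: fun_eq_iff)+

end

subsection \<open>Symmetric functions\<close>

text \<open>\<open>map_key \<sigma> m\<close> is the composition \<open>m \<circ> \<sigma>\<close>, for injective \<open>\<sigma>\<close>.\<close>

definition symmetric_series :: "mseries \<Rightarrow> bool" where
  "symmetric_series f \<longleftrightarrow> (\<forall>\<sigma> m. bij \<sigma> \<longrightarrow> mcoeff f (Poly_Mapping.map_key \<sigma> m) = mcoeff f m)"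

definition bounded_degree :: "mseries \<Rightarrow> bool" where
  "bounded_degree f \<longleftrightarrow> (\<exists>d. \<forall>m. mcoeff f m \<noteq> 0 \<longrightarrow> csize m \<le> d)"

definition sym_funs :: "mseries set" where
  "sym_funs = {f. symmetric_series f \<and> bounded_degree f}"

text \<open>Polynomials over the integers in finitely many of the \<open>X\<^sub>i\<close>, with the convolution product.\<close>

type_synonym mpolynomial = "composition \<Rightarrow>\<^sub>0 int"

definition var :: "nat \<Rightarrow> mpolynomial" where
  "var i = Poly_Mapping.single (Poly_Mapping.single i 1) 1"

definition series_of_poly :: "mpolynomial \<Rightarrow> mseries" where
  "series_of_poly p = Abs_mseries (Poly_Mapping.lookup p)"

text \<open>
  The infinite sum \<open>\<Sum>i. X\<^sub>i ^ k\<close> is formed coefficientwise; for \<open>k > 0\<close> each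
  coefficient receives only finitely many nonzero contributions.
\<close>

definition power_sum :: "nat \<Rightarrow> mseries" where
  "power_sum k = Abs_mseries (\<lambda>m. Sum_any (\<lambda>i. Poly_Mapping.lookup (var i ^ k) m))"

text \<open>Setting \<open>X\<^sub>i = 0\<close> for all \<open>i \<ge> n\<close>.\<close>

definition truncate_vars :: "nat \<Rightarrow> mseries \<Rightarrow> mseries" where
  "truncate_vars n f = Abs_mseries (\<lambda>m. if m \<in> vecs n then mcoeff f m else 0)"

subsection \<open>Schur functions\<close>

definition alternant :: "nat \<Rightarrow> composition \<Rightarrow> mpolynomial" where
  "alternant n \<alpha> =
     (\<Sum>\<sigma> | \<sigma> permutes {..<n}. of_int (sign \<sigma>) * (\<Prod>i<n. var (\<sigma> i) ^ Poly_Mapping.lookup \<alpha> i))"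

definition staircase :: "nat \<Rightarrow> composition" where
  "staircase n = (\<Sum>i<n. Poly_Mapping.single i (n - 1 - i))"

text \<open>
  The quotient of alternants is the exact quotient in the polynomial ring, which is an
  integral domain.
\<close>

definition schur_poly :: "nat \<Rightarrow> composition \<Rightarrow> mpolynomial" where
  "schur_poly n \<alpha> =
     (if \<alpha> \<in> vecs n
      then THE q. q * alternant n (staircase n) = alternant n (staircase n + \<alpha>)
      else 0)"

definition schur :: "composition \<Rightarrow> mseries" where
  "schur \<alpha> =
     (THE f. f \<in> sym_funs \<and> (\<forall>n. truncate_vars n f = series_of_poly (schur_poly n \<alpha>)))"

end

theory Submission
  imports Defs
begin

text \<open>
  It suffices to compare both sides after setting \<open>X\<^sub>i = 0\<close> for \<open>i \<ge> N\<close>, for all large \<open>N\<close>, and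
  after multiplication with the alternant of the staircase \<open>\<delta>\<close>. There \<open>p\<^sub>k\<close> acts by
  \<open>p\<^sub>k a\<^bsub>\<delta> + \<mu>\<^esub> = \<Sum>i. a\<^bsub>\<delta> + \<mu> + k e\<^sub>i\<^esub>\<close>. A summand with a repeated exponent vanishes; otherwise
  the raised exponent is moved up past those it exceeds, a cycle of length \<open>h + 1\<close>, and the sorted
  exponent is \<open>\<delta> + \<nu>\<close> where \<open>\<nu>/\<mu>\<close> is a ribbon of height \<open>h\<close> starting in row \<open>i\<close>. Every
  \<open>k\<close>-ribbon arises once in this way.

  That the Schur functions exist is part of the proof, as \<open>schur\<close> and \<open>schur_poly\<close> are definite
  descriptions. The division of alternants uses the analogous rule for elementary symmetric
  functions, which is triangular with respect to a weight on exponents.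
\<close>

subsection \<open>Homomorphisms of the ring of series\<close>

text \<open>Both halves of the problem are governed by the strictly decreasing integers
  \<open>edge \<nu> l\<close>. On one side, the exponent of \<open>\<delta> + \<nu>\<close> in
  position \<open>l < N\<close> is \<open>edge \<nu> l + N - 1\<close>, so up to a shift the
  exponents do not depend on \<open>N\<close>. On the other side, row \<open>l\<close> of
  \<open>\<nu>/\<mu>\<close> fills exactly the diagonals \<open>e\<close> with
  \<open>edge \<mu> l \<le> e < edge \<nu> l\<close>. Sorting the raised exponent and adding a
  ribbon are therefore one and the same move: the value \<open>edge \<mu> i\<close> is replaced by
  \<open>edge \<mu> i + k\<close>, and the intervals of the rows it passes tile the \<open>k\<close>
  diagonals in between. Divisibility of alternants alone does not produce a Schur function. The
  quotients for different numbers of indeterminates must agree after setting the last one to zero,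
  must be symmetric, and must have degrees bounded independently of that number. This is why the
  division carries an explicit degree bound. Each of these identities is proved by multiplying back
  with the alternant and cancelling, which is possible because polynomials form an integral
  domain.\<close>

lemma Abs_mseries_coeff [simp]: "mcoeff (Abs_mseries c) m = c m"
  by (simp add: Abs_mseries_inverse)

lemma mcoeff_mult: "mcoeff (f * g) m = (\<Sum>(a, b) | a + b = m. mcoeff f a * mcoeff g b)"
  by (simp only: times_mseries.rep_eq)

lemma mcoeff_sum: "mcoeff (\<Sum>i\<in>I. f i) m = (\<Sum>i\<in>I. mcoeff (f i) m)"
  by (induction I rule: infinite_finite_induct) (simp_all add: zero_mseries.rep_eq plus_mseries.rep_eq)

lemma mcoeff_nonzero_multE:
  assumes "mcoeff (f * g) m \<noteq> 0"
  obtains a b where "a + b = m" "mcoeff f a \<noteq> 0" "mcoeff g b \<noteq> 0"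
proof -
  have "\<exists>p\<in>{(a, b). a + b = m}. (case p of (a, b) \<Rightarrow> mcoeff f a * mcoeff g b) \<noteq> 0"
    using assms unfolding mcoeff_mult by (meson sum.not_neutral_contains_not_neutral)
  with that show thesis by auto
qed

text \<open>Truncation and permutation of the indeterminates are both instances. Alternants are
  built from integers and the \<open>X i\<close> by ring operations, so such a map is known on them
  once its values on the \<open>X i\<close> are.\<close>

locale mseries_hom =
  fixes h :: "mseries \<Rightarrow> mseries"
  assumes hom_1: "h 1 = 1"
    and hom_add: "h (f + g) = h f + h g"
    and hom_mult: "h (f * g) = h f * h g"
begin

lemma hom_0: "h 0 = 0"
  using hom_add[of 0 0] by simp

lemma hom_uminus: "h (- f) = - h f"
proof -
  have "h (- f) + h f = 0"
    using hom_add[of "- f" f] by (simp add: hom_0)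
  then show ?thesis by (simp only: eq_neg_iff_add_eq_0)
qed

lemma hom_sum: "h (\<Sum>i\<in>I. f i) = (\<Sum>i\<in>I. h (f i))"
  by (induction I rule: infinite_finite_induct) (simp_all add: hom_0 hom_add)

lemma hom_prod: "h (\<Prod>i\<in>I. f i) = (\<Prod>i\<in>I. h (f i))"
  by (induction I rule: infinite_finite_induct) (simp_all add: hom_1 hom_mult)

lemma hom_power: "h (f ^ k) = h f ^ k"
  by (induction k) (simp_all add: hom_1 hom_mult)

lemma hom_of_nat: "h (of_nat k) = of_nat k"
  by (induction k) (simp_all add: hom_0 hom_1 hom_add)

lemma hom_of_int: "h (of_int z) = of_int z"
  by (cases z) (simp_all add: hom_of_nat hom_uminus del: of_nat_Suc)

end

subsection \<open>Polynomials as power series\<close>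

lemma mcoeff_poly [simp]: "mcoeff (series_of_poly p) m = Poly_Mapping.lookup p m"
  by (simp add: series_of_poly_def)

lemma series_of_poly_inject [simp]: "series_of_poly p = series_of_poly q \<longleftrightarrow> p = q"
  by (metis mcoeff_poly poly_mapping_eqI)

lemma series_of_poly_0 [simp]: "series_of_poly 0 = 0"
  by (rule mseries_eqI) (simp add: zero_mseries.rep_eq)

lemma series_of_poly_eq_0_iff [simp]: "series_of_poly p = 0 \<longleftrightarrow> p = 0"
  using series_of_poly_inject[of p 0] by simp

lemma series_of_poly_1 [simp]: "series_of_poly 1 = 1"
  by (rule mseries_eqI) (simp add: one_mseries.rep_eq lookup_one when_def)

lemma series_of_poly_add [simp]: "series_of_poly (p + q) = series_of_poly p + series_of_poly q"
  by (rule mseries_eqI) (simp add: plus_mseries.rep_eq lookup_add)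

lemma series_of_poly_uminus [simp]: "series_of_poly (- p) = - series_of_poly p"
  by (rule mseries_eqI) (simp add: uminus_mseries.rep_eq)

text \<open>The product of \<open>poly_mapping\<close>s is a double \<open>Sum_any\<close>, that of
  series a finite sum over pairs. The inner sum \<open>F a\<close> collapses to the single
  \<open>b\<close> with \<open>a + b = m\<close>, and is zero if there is none.\<close>

lemma series_of_poly_mult [simp]: "series_of_poly (p * q) = series_of_poly p * series_of_poly q"
proof (rule mseries_eqI)
  fix m :: composition
  let ?P = "{(a, b). a + b = m}"
  define F where "F a = (\<Sum>b. Poly_Mapping.lookup q b when m = a + b)" for a :: composition
  have F: "F (fst x) = Poly_Mapping.lookup q (snd x)" if "x \<in> ?P" for x
  proof -
    have "(\<lambda>b. Poly_Mapping.lookup q b when m = fst x + b) =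
        (\<lambda>b. Poly_Mapping.lookup q b when snd x = b)"
      using that by (auto simp: fun_eq_iff when_def)
    then have "F (fst x) = (\<Sum>b. Poly_Mapping.lookup q b when snd x = b)"
      unfolding F_def by (rule arg_cong)
    also have "\<dots> = (\<Sum>b. if snd x = b then Poly_Mapping.lookup q b else 0)"
      by (simp only: when_def)
    finally show ?thesis by (simp only: Sum_any.delta')
  qed
  have "F a = 0" if "a \<notin> fst ` ?P" for a
  proof -
    have "(\<lambda>b. Poly_Mapping.lookup q b when m = a + b) = (\<lambda>b :: composition. 0)"
      using that by (auto simp: fun_eq_iff when_def image_def)
    then have "F a = (\<Sum>b :: composition. 0)"
      unfolding F_def by (rule arg_cong)
    then show ?thesis by simp
  qed
  then have "{a. Poly_Mapping.lookup p a * F a \<noteq> 0} \<subseteq> fst ` ?P"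
    by auto
  then have "Poly_Mapping.lookup (p * q) m = (\<Sum>a\<in>fst ` ?P. Poly_Mapping.lookup p a * F a)"
    unfolding lookup_mult F_def [symmetric]
    by (intro Sum_any.expand_superset) (use finite_composition_pairs in auto)
  also have "\<dots> = (\<Sum>x\<in>?P. Poly_Mapping.lookup p (fst x) * F (fst x))"
    by (intro sum.reindex_cong[OF _ refl]) (auto simp: inj_on_def)
  also have "\<dots> = (\<Sum>(a, b)\<in>?P. Poly_Mapping.lookup p a * Poly_Mapping.lookup q b)"
    using F by (intro sum.cong) (auto simp: case_prod_unfold)
  finally show "mcoeff (series_of_poly (p * q)) m = mcoeff (series_of_poly p * series_of_poly q) m"
    by (simp add: mcoeff_mult)
qed

lemma series_of_poly_sum: "series_of_poly (\<Sum>i\<in>I. f i) = (\<Sum>i\<in>I. series_of_poly (f i))"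
  by (induction I rule: infinite_finite_induct) simp_all

lemma series_of_poly_prod: "series_of_poly (\<Prod>i\<in>I. f i) = (\<Prod>i\<in>I. series_of_poly (f i))"
  by (induction I rule: infinite_finite_induct) simp_all

lemma series_of_poly_power: "series_of_poly (f ^ k) = series_of_poly f ^ k"
  by (induction k) simp_all

lemma series_of_poly_of_nat: "series_of_poly (of_nat k) = of_nat k"
  by (induction k) simp_all

lemma series_of_poly_of_int: "series_of_poly (of_int z) = of_int z"
  by (cases z) (simp_all add: series_of_poly_of_nat del: of_nat_Suc)

text \<open>Carries the integral domain property of \<open>mpolynomial\<close> over to the ring of
  series, in which the computations take place.\<close>

definition polys :: "mseries set" where
  "polys = range series_of_poly"

lemma series_of_poly_in_polys [simp]: "series_of_poly p \<in> polys"
  by (simp add: polys_def)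

lemma polys_iff_finite: "f \<in> polys \<longleftrightarrow> finite {m. mcoeff f m \<noteq> 0}"
proof
  assume "finite {m. mcoeff f m \<noteq> 0}"
  then have "series_of_poly (Abs_poly_mapping (mcoeff f)) = f"
    by (intro mseries_eqI) simp
  then show "f \<in> polys" by (metis series_of_poly_in_polys)
qed (auto simp: polys_def)

lemma polys_0 [simp]: "0 \<in> polys"
  using series_of_poly_in_polys[of 0] by simp

lemma polys_1 [simp]: "1 \<in> polys"
  using series_of_poly_in_polys[of 1] by simp

lemma polys_add: "f \<in> polys \<Longrightarrow> g \<in> polys \<Longrightarrow> f + g \<in> polys"
  unfolding polys_def by (elim rangeE) (simp only: series_of_poly_add [symmetric] rangeI)

lemma polys_uminus: "f \<in> polys \<Longrightarrow> - f \<in> polys"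
  unfolding polys_def by (elim rangeE) (simp only: series_of_poly_uminus [symmetric] rangeI)

lemma polys_diff: "f \<in> polys \<Longrightarrow> g \<in> polys \<Longrightarrow> f - g \<in> polys"
  using polys_add[of f "- g"] by (simp add: polys_uminus)

lemma polys_mult: "f \<in> polys \<Longrightarrow> g \<in> polys \<Longrightarrow> f * g \<in> polys"
  unfolding polys_def by (elim rangeE) (simp only: series_of_poly_mult [symmetric] rangeI)

lemma polys_mult_eq_0_iff:
  assumes "f \<in> polys" "g \<in> polys"
  shows "f * g = 0 \<longleftrightarrow> f = 0 \<or> g = 0"
proof -
  obtain p q where "f = series_of_poly p" "g = series_of_poly q"
    using assms by (auto simp: polys_def)
  moreover have "series_of_poly p * series_of_poly q = 0 \<longleftrightarrow> p * q = 0"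
    by (simp only: series_of_poly_mult [symmetric] series_of_poly_eq_0_iff)
  ultimately show ?thesis by simp
qed

lemma polys_cancel:
  assumes "f \<in> polys" "g \<in> polys" "a \<in> polys" "a \<noteq> 0" "f * a = g * a"
  shows "f = g"
  using polys_mult_eq_0_iff[OF polys_diff[OF assms(1,2)] assms(3)] assms(4,5)
  by (simp add: left_diff_distrib)

lemma polys_sum: "(\<And>i. i \<in> I \<Longrightarrow> f i \<in> polys) \<Longrightarrow> (\<Sum>i\<in>I. f i) \<in> polys"
  by (induction I rule: infinite_finite_induct) (auto intro: polys_add)

definition X :: "nat \<Rightarrow> mseries" where
  "X i = series_of_poly (var i)"

lemma mcoeff_X: "mcoeff (X i) m = (if m = Poly_Mapping.single i 1 then 1 else 0)"
  by (auto simp: X_def var_def lookup_single when_def)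

lemma X_in_polys [simp]: "X i \<in> polys"
  by (simp add: X_def)

lemma X_nonzero [simp]: "X i \<noteq> 0"
  using mcoeff_X[of i "Poly_Mapping.single i 1"] by (auto simp: zero_mseries.rep_eq)

lemma prod_X_nonzero:
  assumes "finite I"
  shows "(\<Prod>i\<in>I. X i) \<in> polys \<and> (\<Prod>i\<in>I. X i) \<noteq> 0"
  using assms by (induction I rule: finite_induct)
    (auto simp: polys_mult polys_mult_eq_0_iff)

subsection \<open>Truncation and permutation of the indeterminates\<close>

lemma mcoeff_truncate [simp]:
  "mcoeff (truncate_vars n f) m = (if m \<in> vecs n then mcoeff f m else 0)"
  by (simp add: truncate_vars_def)

lemma vecs_iff: "m \<in> vecs n \<longleftrightarrow> (\<forall>i\<ge>n. Poly_Mapping.lookup m i = 0)"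
  unfolding vecs_def subset_eq mem_Collect_eq Ball_def lessThan_iff in_keys_iff by (meson not_le)

lemma vecs_lookup_eq_0: "m \<in> vecs n \<Longrightarrow> n \<le> i \<Longrightarrow> Poly_Mapping.lookup m i = 0"
  by (simp add: vecs_iff)

lemma vecs_add_iff: "a + b \<in> vecs n \<longleftrightarrow> a \<in> vecs n \<and> b \<in> vecs n"
  by (auto simp: vecs_iff lookup_add)

lemma vecs_mono: "m \<in> vecs n \<Longrightarrow> n \<le> n' \<Longrightarrow> m \<in> vecs n'"
  unfolding vecs_iff by (meson order_trans)

lemma ex_vecs: "\<exists>n. m \<in> vecs n \<and> N \<le> n"
proof -
  obtain n where "\<forall>i\<in>Poly_Mapping.keys m. i < n"
    using finite_keys[of m] unfolding finite_nat_set_iff_bounded by blast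
  then have "m \<in> vecs n"
    by (simp add: vecs_def subset_eq)
  then have "m \<in> vecs (max n N)"
    by (rule vecs_mono) simp
  then show ?thesis by (intro exI[of _ "max n N"]) simp
qed

interpretation truncate: mseries_hom "truncate_vars n" for n
proof
  show "truncate_vars n 1 = 1"
    by (rule mseries_eqI) (auto simp: one_mseries.rep_eq vecs_def)
  show "truncate_vars n (f + g) = truncate_vars n f + truncate_vars n g" for f g
    by (rule mseries_eqI) (auto simp: plus_mseries.rep_eq)
  show "truncate_vars n (f * g) = truncate_vars n f * truncate_vars n g" for f g
  proof (rule mseries_eqI)
    fix m
    show "mcoeff (truncate_vars n (f * g)) m = mcoeff (truncate_vars n f * truncate_vars n g) m"
    proof (cases "m \<in> vecs n")
      case True
      then have "(\<Sum>(a, b) | a + b = m. mcoeff f a * mcoeff g b) =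
          (\<Sum>(a, b) | a + b = m. mcoeff (truncate_vars n f) a * mcoeff (truncate_vars n g) b)"
        by (intro sum.cong) (auto simp: vecs_add_iff)
      with True show ?thesis by (simp add: mcoeff_mult)
    next
      case False
      then have "(\<Sum>(a, b) | a + b = m. mcoeff (truncate_vars n f) a * mcoeff (truncate_vars n g) b) = 0"
        by (intro sum.neutral) (auto simp: vecs_add_iff)
      with False show ?thesis by (simp add: mcoeff_mult)
    qed
  qed
qed

lemma truncate_X: "truncate_vars n (X i) = (if i < n then X i else 0)"
  by (rule mseries_eqI) (auto simp: mcoeff_X zero_mseries.rep_eq vecs_def split: if_splits)

lemma truncate_truncate: "n \<le> n' \<Longrightarrow> truncate_vars n (truncate_vars n' f) = truncate_vars n f"
  by (rule mseries_eqI) (auto dest: vecs_mono)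

lemma truncate_in_polys: "f \<in> polys \<Longrightarrow> truncate_vars n f \<in> polys"
  unfolding polys_iff_finite by (erule finite_subset[rotated]) auto

text \<open>The action used in \<open>symmetric_series\<close>: a series is symmetric iff every
  bijection fixes it under \<open>permute_vars\<close>.\<close>

definition permute_vars :: "(nat \<Rightarrow> nat) \<Rightarrow> mseries \<Rightarrow> mseries" where
  "permute_vars \<pi> f = Abs_mseries (\<lambda>m. mcoeff f (Poly_Mapping.map_key \<pi> m))"

lemma mcoeff_permute [simp]: "mcoeff (permute_vars \<pi> f) m = mcoeff f (Poly_Mapping.map_key \<pi> m)"
  by (simp add: permute_vars_def)

lemma lookup_map_key: "inj \<sigma> \<Longrightarrow> Poly_Mapping.lookup (Poly_Mapping.map_key \<sigma> m) i = Poly_Mapping.lookup m (\<sigma> i)"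
  by (simp add: map_key.rep_eq)

lemma map_key_map_key_inv:
  fixes m :: composition
  assumes "bij \<sigma>"
  shows "Poly_Mapping.map_key \<sigma> (Poly_Mapping.map_key (inv \<sigma>) m) = m"
    and "Poly_Mapping.map_key (inv \<sigma>) (Poly_Mapping.map_key \<sigma> m) = m"
  using assms by (auto intro!: poly_mapping_eqI
      simp: lookup_map_key bij_is_inj bij_imp_bij_inv surj_f_inv_f bij_is_surj)

lemma mseries_hom_permute:
  assumes "bij \<pi>"
  shows "mseries_hom (permute_vars \<pi>)"
proof
  note inj = bij_is_inj[OF assms] bij_is_inj[OF bij_imp_bij_inv[OF assms]]
  note inv = map_key_map_key_inv[OF assms]
  have zero: "Poly_Mapping.map_key \<pi> m = 0 \<longleftrightarrow> m = 0" for m :: composition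
    using inv(2)[of m] by (auto simp: map_key_zero[OF inj(1)] map_key_zero[OF inj(2)])
  show "permute_vars \<pi> 1 = 1"
    by (rule mseries_eqI) (auto simp: one_mseries.rep_eq zero)
  show "permute_vars \<pi> (f + g) = permute_vars \<pi> f + permute_vars \<pi> g" for f g
    by (rule mseries_eqI) (auto simp: plus_mseries.rep_eq)
  show "permute_vars \<pi> (f * g) = permute_vars \<pi> f * permute_vars \<pi> g" for f g
    by (rule mseries_eqI, simp add: mcoeff_mult,
        rule sum.reindex_bij_witness[where
            i = "\<lambda>(a, b). (Poly_Mapping.map_key \<pi> a, Poly_Mapping.map_key \<pi> b)" and
            j = "\<lambda>(a, b). (Poly_Mapping.map_key (inv \<pi>) a, Poly_Mapping.map_key (inv \<pi>) b)"])
       (auto simp: inv inj simp flip: map_key_plus)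
qed

lemma permute_X:
  assumes "bij \<pi>"
  shows "permute_vars \<pi> (X i) = X (\<pi> i)"
proof (rule mseries_eqI)
  fix m :: composition
  note inj = bij_is_inj[OF assms] bij_is_inj[OF bij_imp_bij_inv[OF assms]]
  note inv = map_key_map_key_inv[OF assms]
  have "Poly_Mapping.map_key \<pi> m = Poly_Mapping.single i 1 \<longleftrightarrow> m = Poly_Mapping.single (\<pi> i) 1"
  proof
    assume eq: "Poly_Mapping.map_key \<pi> m = Poly_Mapping.single i 1"
    have "Poly_Mapping.map_key (inv \<pi>) (Poly_Mapping.single (inv \<pi> (\<pi> i)) (1 :: nat)) =
        Poly_Mapping.single (\<pi> i) 1"
      by (rule map_key_single[OF inj(2)])
    with eq show "m = Poly_Mapping.single (\<pi> i) 1"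
      using inv(2)[of m] inj(1) by (simp add: inv_f_f)
  qed (simp add: map_key_single[OF inj(1)])
  then show "mcoeff (permute_vars \<pi> (X i)) m = mcoeff (X (\<pi> i)) m"
    by (simp add: mcoeff_X)
qed

lemma permute_in_polys:
  assumes "bij \<pi>" "f \<in> polys"
  shows "permute_vars \<pi> f \<in> polys"
proof -
  have "{m. mcoeff (permute_vars \<pi> f) m \<noteq> 0} \<subseteq> Poly_Mapping.map_key (inv \<pi>) ` {m. mcoeff f m \<noteq> 0}"
  proof
    fix m assume "m \<in> {m. mcoeff (permute_vars \<pi> f) m \<noteq> 0}"
    then show "m \<in> Poly_Mapping.map_key (inv \<pi>) ` {m. mcoeff f m \<noteq> 0}"
      by (intro image_eqI[of _ _ "Poly_Mapping.map_key \<pi> m"])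
        (simp_all add: map_key_map_key_inv(2)[OF assms(1)])
  qed
  moreover have "finite {m. mcoeff f m \<noteq> 0}"
    using assms(2) by (simp only: polys_iff_finite)
  ultimately show ?thesis
    unfolding polys_iff_finite by (meson finite_imageI finite_subset)
qed

subsection \<open>Degrees\<close>

lemma csize_eq_sum: "m \<in> vecs n \<Longrightarrow> csize m = (\<Sum>i<n. Poly_Mapping.lookup m i)"
  unfolding csize_def vecs_def by (intro sum.mono_neutral_left) (auto simp: in_keys_iff)

lemma csize_add: "csize (a + b) = csize a + csize b"
proof -
  obtain n where "a + b \<in> vecs n" using ex_vecs by blast
  moreover from this have "a \<in> vecs n" "b \<in> vecs n" by (auto simp: vecs_add_iff)
  ultimately show ?thesis
    by (simp add: csize_eq_sum lookup_add sum.distrib)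
qed

text \<open>The bound is a parameter because the degrees of \<open>schur_poly n \<nu>\<close> have
  to be bounded uniformly in \<open>n\<close>.\<close>

definition deg_le :: "nat \<Rightarrow> mseries \<Rightarrow> bool" where
  "deg_le d f \<longleftrightarrow> (\<forall>m. mcoeff f m \<noteq> 0 \<longrightarrow> csize m \<le> d)"

lemma deg_le_mult:
  assumes "deg_le d f" "deg_le e g"
  shows "deg_le (d + e) (f * g)"
  unfolding deg_le_def
proof (intro allI impI)
  fix m assume "mcoeff (f * g) m \<noteq> 0"
  then obtain a b where "a + b = m" "mcoeff f a \<noteq> 0" "mcoeff g b \<noteq> 0"
    by (rule mcoeff_nonzero_multE)
  with assms show "csize m \<le> d + e"
    unfolding deg_le_def by (metis add_mono csize_add)
qed

lemma deg_le_diff: "deg_le d f \<Longrightarrow> deg_le d g \<Longrightarrow> deg_le d (f - g)"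
  by (force simp: deg_le_def minus_mseries.rep_eq)

lemma deg_le_sum: "(\<And>i. i \<in> I \<Longrightarrow> deg_le d (f i)) \<Longrightarrow> deg_le d (\<Sum>i\<in>I. f i)"
  unfolding deg_le_def mcoeff_sum by (meson sum.not_neutral_contains_not_neutral)

lemma deg_le_X: "deg_le 1 (X i)"
  by (auto simp: deg_le_def mcoeff_X csize_def)

lemma deg_le_1: "deg_le 0 1"
  by (auto simp: deg_le_def one_mseries.rep_eq csize_def)

lemma deg_le_prod_X: "finite S \<Longrightarrow> deg_le (card S) (\<Prod>i\<in>S. X i)"
proof (induction S rule: finite_induct)
  case (insert x F)
  then show ?case using deg_le_mult[OF deg_le_X, of _ _ x] by fastforce
qed (simp add: deg_le_1)

subsection \<open>Alternants\<close>

text \<open>Exponents are plain functions, so that \<open>g \<circ> \<pi>\<close> and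
  \<open>g(i := ...)\<close> can be formed without finite support arguments; by
  \<open>alt_cong\<close> only the values below \<open>n\<close> count.\<close>

definition alt :: "nat \<Rightarrow> (nat \<Rightarrow> nat) \<Rightarrow> mseries" where
  "alt n g = (\<Sum>\<sigma> | \<sigma> permutes {..<n}. of_int (sign \<sigma>) * (\<Prod>i<n. X (\<sigma> i) ^ g i))"

lemma alt_eq_poly:
  "alt n g = series_of_poly
    (\<Sum>\<sigma> | \<sigma> permutes {..<n}. of_int (sign \<sigma>) * (\<Prod>i<n. var (\<sigma> i) ^ g i))"
  by (simp add: alt_def X_def series_of_poly_sum series_of_poly_prod series_of_poly_power
      series_of_poly_of_int)

lemma alt_lookup: "alt n (Poly_Mapping.lookup \<alpha>) = series_of_poly (alternant n \<alpha>)"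
  by (simp add: alt_eq_poly alternant_def)

lemma alt_in_polys [simp]: "alt n g \<in> polys"
  by (simp add: alt_eq_poly)

lemma alt_cong: "(\<And>i. i < n \<Longrightarrow> g i = h i) \<Longrightarrow> alt n g = alt n h"
  by (simp add: alt_def)

lemma sign_compose_permutes:
  "\<sigma> permutes {..<n} \<Longrightarrow> \<pi> permutes {..<n} \<Longrightarrow> sign (\<sigma> \<circ> \<pi>) = sign \<sigma> * sign \<pi>"
  for n :: nat
  by (intro sign_compose) (auto simp: permutation_permutes)

lemma of_int_sign_square [simp]: "of_int (sign \<pi>) * (of_int (sign \<pi>) * f) = (f :: mseries)"
proof -
  have "of_int (sign \<pi>) * (of_int (sign \<pi>) * f) = of_int (sign \<pi> * sign \<pi>) * f"
    by (simp only: of_int_mult mult.assoc)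
  then show ?thesis by (simp only: sign_idempotent of_int_1 mult_1)
qed

text \<open>Reindexing the product by \<open>\<pi>\<close> turns \<open>\<sigma>\<close> into
  \<open>\<sigma> \<circ> \<pi>\<close>, and right composition with \<open>\<pi>\<close> permutes
  the summands. Permuting the indeterminates instead, as in \<open>permute_alt\<close>, composes on
  the left.\<close>

lemma alt_compose:
  assumes "\<pi> permutes {..<n}"
  shows "alt n (g \<circ> \<pi>) = of_int (sign \<pi>) * alt n g"
proof -
  have "(\<Prod>i<n. X (\<sigma> i) ^ g i) = (\<Prod>i<n. X (\<sigma> (\<pi> i)) ^ g (\<pi> i))" for \<sigma>
    using prod.permute[OF assms, of "\<lambda>i. X (\<sigma> i) ^ g i"] by (simp only: o_def)
  then have alt: "alt n g = (\<Sum>\<sigma> | \<sigma> permutes {..<n}. of_int (sign \<sigma>) * (\<Prod>i<n. X (\<sigma> (\<pi> i)) ^ g (\<pi> i)))"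
    by (simp only: alt_def)
  have "of_int (sign \<pi>) * alt n g =
      (\<Sum>\<sigma> | \<sigma> permutes {..<n}. of_int (sign (\<sigma> \<circ> \<pi>)) * (\<Prod>i<n. X ((\<sigma> \<circ> \<pi>) i) ^ (g \<circ> \<pi>) i))"
    unfolding alt sum_distrib_left
  proof (rule sum.cong)
    fix \<sigma> assume "\<sigma> \<in> {\<sigma>. \<sigma> permutes {..<n}}"
    then show "of_int (sign \<pi>) * (of_int (sign \<sigma>) * (\<Prod>i<n. X (\<sigma> (\<pi> i)) ^ g (\<pi> i))) =
        of_int (sign (\<sigma> \<circ> \<pi>)) * (\<Prod>i<n. X ((\<sigma> \<circ> \<pi>) i) ^ (g \<circ> \<pi>) i)"
      by (simp add: sign_compose_permutes[OF _ assms] mult.left_commute mult.assoc)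
  qed simp
  also have "\<dots> = alt n (g \<circ> \<pi>)"
    unfolding alt_def by (rule sum_permutations_compose_right[OF assms, symmetric])
  finally show ?thesis by (rule sym)
qed

lemma permute_alt:
  assumes "\<pi> permutes {..<n}"
  shows "permute_vars \<pi> (alt n g) = of_int (sign \<pi>) * alt n g"
proof -
  interpret mseries_hom "permute_vars \<pi>"
    using permutes_bij[OF assms] by (rule mseries_hom_permute)
  have "permute_vars \<pi> (alt n g) =
      (\<Sum>\<sigma> | \<sigma> permutes {..<n}. of_int (sign \<sigma>) * (\<Prod>i<n. X (\<pi> (\<sigma> i)) ^ g i))"
    by (simp add: alt_def hom_sum hom_mult hom_of_int hom_prod hom_power permute_X permutes_bij[OF assms])
  also have "\<dots> = of_int (sign \<pi>) *
      (\<Sum>\<sigma> | \<sigma> permutes {..<n}. of_int (sign (\<pi> \<circ> \<sigma>)) * (\<Prod>i<n. X ((\<pi> \<circ> \<sigma>) i) ^ g i))"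
    unfolding sum_distrib_left
    by (intro sum.cong refl) (simp add: sign_compose_permutes[OF assms] mult.assoc)
  also have "\<dots> = of_int (sign \<pi>) * alt n g"
    unfolding alt_def
    by (rule arg_cong[where f = "(*) (of_int (sign \<pi>))"])
       (rule setum_permutations_compose_left[OF assms, symmetric])
  finally show ?thesis .
qed

lemma alt_eq_0:
  assumes "i < n" "j < n" "i \<noteq> j" "g i = g j"
  shows "alt n g = 0"
proof -
  have "g \<circ> transpose i j = g"
    using assms(4) by (auto simp: fun_eq_iff transpose_def)
  moreover have "transpose i j permutes {..<n}"
    using assms by (intro permutes_swap_id) auto
  ultimately have "alt n g = - alt n g"
    using alt_compose[of "transpose i j" n g] assms(3) by (simp add: sign_swap_id)
  \<comment> \<open>Passing to coefficients, since an integer equal to its negative is 0.\<close>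
  then have "mcoeff (alt n g) m = - mcoeff (alt n g) m" for m
    using arg_cong[of "alt n g" "- alt n g" "\<lambda>f. mcoeff f m"] by (simp add: uminus_mseries.rep_eq)
  then show ?thesis
    by (intro mseries_eqI) (simp add: zero_mseries.rep_eq)
qed

text \<open>
  The symmetry hypothesis lets the sum of monomials be rewritten in the permuted
  indeterminates, separately inside each summand of the alternant.
\<close>

lemma alt_mult_symmetric:
  assumes "\<And>\<sigma>. \<sigma> permutes {..<n} \<Longrightarrow> (\<Sum>b\<in>B. \<Prod>i<n. X (\<sigma> i) ^ e b i) = f"
  shows "f * alt n g = (\<Sum>b\<in>B. alt n (\<lambda>i. g i + e b i))"
proof -
  have "f * alt n g = (\<Sum>\<sigma> | \<sigma> permutes {..<n}.
      (\<Sum>b\<in>B. of_int (sign \<sigma>) * (\<Prod>i<n. X (\<sigma> i) ^ (g i + e b i))))"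
    unfolding alt_def sum_distrib_left
  proof (intro sum.cong refl)
    fix \<sigma> assume "\<sigma> \<in> {\<sigma>. \<sigma> permutes {..<n}}"
    then have "f = (\<Sum>b\<in>B. \<Prod>i<n. X (\<sigma> i) ^ e b i)"
      using assms by simp
    then have "f * (of_int (sign \<sigma>) * (\<Prod>i<n. X (\<sigma> i) ^ g i)) =
        of_int (sign \<sigma>) * (\<Prod>i<n. X (\<sigma> i) ^ g i) * (\<Sum>b\<in>B. \<Prod>i<n. X (\<sigma> i) ^ e b i)"
      by (simp only: mult.commute)
    also have "\<dots> = (\<Sum>b\<in>B. of_int (sign \<sigma>) * (\<Prod>i<n. X (\<sigma> i) ^ (g i + e b i)))"
      by (simp only: power_add prod.distrib sum_distrib_left mult.assoc)
    finally show "f * (of_int (sign \<sigma>) * (\<Prod>i<n. X (\<sigma> i) ^ g i)) =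
        (\<Sum>b\<in>B. of_int (sign \<sigma>) * (\<Prod>i<n. X (\<sigma> i) ^ (g i + e b i)))" .
  qed
  then show ?thesis
    unfolding alt_def by (subst sum.swap) simp
qed

section \<open>Products of alternants with power sums and elementary symmetric functions\<close>

lemma power_sum_mult_alt:
  "(\<Sum>i<n. X i ^ k) * alt n g = (\<Sum>i<n. alt n (g(i := g i + k)))"
proof -
  have "(\<Sum>b<n. \<Prod>i<n. X (\<sigma> i) ^ (if i = b then k else 0)) = (\<Sum>i<n. X i ^ k)"
    if "\<sigma> permutes {..<n}" for \<sigma>
  proof -
    have "(\<Prod>i<n. X (\<sigma> i) ^ (if i = b then k else 0)) = X (\<sigma> b) ^ k" if "b < n" for b
    proof -
      have "(\<Prod>i<n. X (\<sigma> i) ^ (if i = b then k else 0)) = (\<Prod>i<n. if i = b then X (\<sigma> i) ^ k else 1)"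
        by (intro prod.cong) auto
      with that show ?thesis by (simp add: prod.delta)
    qed
    then have "(\<Sum>b<n. \<Prod>i<n. X (\<sigma> i) ^ (if i = b then k else 0)) = (\<Sum>b<n. X (\<sigma> b) ^ k)"
      by simp
    also have "\<dots> = (\<Sum>i<n. X i ^ k)"
      using sum.permute[OF that, of "\<lambda>i. X i ^ k"] by (simp add: o_def)
    finally show ?thesis .
  qed
  then have "(\<Sum>i<n. X i ^ k) * alt n g = (\<Sum>b<n. alt n (\<lambda>i. g i + (if i = b then k else 0)))"
    by (rule alt_mult_symmetric)
  also have "\<dots> = (\<Sum>b<n. alt n (g(b := g b + k)))"
    by (intro sum.cong alt_cong) auto
  finally show ?thesis .
qed

definition elementary :: "nat \<Rightarrow> nat \<Rightarrow> mseries" where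
  "elementary n k = (\<Sum>S | S \<subseteq> {..<n} \<and> card S = k. \<Prod>i\<in>S. X i)"

lemma elementary_mult_alt:
  "elementary n k * alt n g =
    (\<Sum>S | S \<subseteq> {..<n} \<and> card S = k. alt n (\<lambda>i. g i + of_bool (i \<in> S)))"
proof (rule alt_mult_symmetric)
  fix \<sigma> assume \<sigma>: "\<sigma> permutes {..<n}"
  let ?B = "{S. S \<subseteq> {..<n} \<and> card S = k}"
  have "(\<Sum>S\<in>?B. \<Prod>i<n. X (\<sigma> i) ^ of_bool (i \<in> S)) = (\<Sum>S\<in>?B. \<Prod>i\<in>\<sigma> ` S. X i)"
  proof (intro sum.cong refl)
    fix S assume "S \<in> ?B"
    then have "(\<Prod>i<n. X (\<sigma> i) ^ of_bool (i \<in> S)) = (\<Prod>i\<in>S. X (\<sigma> i) ^ of_bool (i \<in> S))"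
      by (intro prod.mono_neutral_right) auto
    also have "\<dots> = (\<Prod>i\<in>S. X (\<sigma> i))" by simp
    also have "\<dots> = (\<Prod>i\<in>\<sigma> ` S. X i)"
      by (rule prod.reindex_cong[symmetric, OF _ refl refl]) (rule permutes_inj_on[OF \<sigma>])
    finally show "(\<Prod>i<n. X (\<sigma> i) ^ of_bool (i \<in> S)) = (\<Prod>i\<in>\<sigma> ` S. X i)" .
  qed
  \<comment> \<open>\<open>\<sigma>\<close> permutes the \<open>k\<close>-subsets of
    \<open>{..<n}\<close> among themselves.\<close>
  also have "\<dots> = (\<Sum>S\<in>?B. \<Prod>i\<in>S. X i)"
  proof (rule sum.reindex_bij_witness[where i = "\<lambda>S. inv \<sigma> ` S" and j = "\<lambda>S. \<sigma> ` S"])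
    have inv: "inv \<sigma> permutes {..<n}" using \<sigma> by (rule permutes_inv)
    fix S assume S: "S \<in> ?B"
    show "inv \<sigma> ` \<sigma> ` S = S" "\<sigma> ` inv \<sigma> ` S = S"
      by (simp_all add: image_image permutes_inverses[OF \<sigma>])
    show "\<sigma> ` S \<in> ?B"
      using S permutes_in_image[OF \<sigma>] card_image[OF permutes_inj_on[OF \<sigma>], of S] by auto
    show "inv \<sigma> ` S \<in> ?B"
      using S permutes_in_image[OF inv] card_image[OF permutes_inj_on[OF inv], of S] by auto
  qed simp
  finally show "(\<Sum>S\<in>?B. \<Prod>i<n. X (\<sigma> i) ^ of_bool (i \<in> S)) = elementary n k"
    by (simp add: elementary_def)
qed

lemma elementary_in_polys: "elementary n k \<in> polys"
  unfolding elementary_def by (intro polys_sum) (auto simp: prod_X_nonzero finite_subset)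

lemma deg_le_elementary: "deg_le k (elementary n k)"
  unfolding elementary_def by (intro deg_le_sum) (auto simp: finite_subset intro: deg_le_prod_X)

section \<open>Alternants under setting the last indeterminate to zero\<close>

lemma truncate_alt_same: "truncate_vars n (alt n g) = alt n g"
proof -
  have "(\<Prod>i<n. truncate_vars n (X (\<sigma> i)) ^ g i) = (\<Prod>i<n. X (\<sigma> i) ^ g i)"
    if "\<sigma> permutes {..<n}" for \<sigma>
    using permutes_in_image[OF that] by (intro prod.cong) (auto simp: truncate_X)
  then show ?thesis
    by (simp add: alt_def truncate.hom_sum truncate.hom_mult truncate.hom_of_int
        truncate.hom_prod truncate.hom_power)
qed

lemma truncate_alt_Suc:
  "truncate_vars n (alt (Suc n) g) =
    (\<Sum>\<sigma> | \<sigma> permutes {..<Suc n}. of_int (sign \<sigma>) * (\<Prod>i<Suc n. (if \<sigma> i < n then X (\<sigma> i) else 0) ^ g i))"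
  by (simp only: alt_def truncate.hom_sum truncate.hom_mult truncate.hom_of_int
        truncate.hom_prod truncate.hom_power truncate_X)

text \<open>Every \<open>\<sigma>\<close> takes the value \<open>n\<close> somewhere, so each
  summand contains a positive power of the vanishing \<open>X n\<close>.\<close>

lemma truncate_alt_Suc_eq_0:
  assumes "\<And>i. i \<le> n \<Longrightarrow> 0 < g i"
  shows "truncate_vars n (alt (Suc n) g) = 0"
  unfolding truncate_alt_Suc
proof (intro sum.neutral ballI)
  fix \<sigma> assume "\<sigma> \<in> {\<sigma>. \<sigma> permutes {..<Suc n}}"
  then have \<sigma>: "\<sigma> permutes {..<Suc n}" by simp
  obtain i where i: "\<sigma> i = n" "i < Suc n"
    using permutes_inverses(1)[OF \<sigma>, of n] permutes_in_image[OF permutes_inv[OF \<sigma>], of n] by auto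
  then have "(if \<sigma> i < n then X (\<sigma> i) else 0) ^ g i = 0"
    using assms[of i] by (simp add: zero_power)
  then have "(\<Prod>i<Suc n. (if \<sigma> i < n then X (\<sigma> i) else 0) ^ g i) = 0"
    using i(2) by (intro prod_zero bexI[of _ i]) simp_all
  then show "of_int (sign \<sigma>) * (\<Prod>i<Suc n. (if \<sigma> i < n then X (\<sigma> i) else 0) ^ g i) = 0"
    by simp
qed

text \<open>Only the \<open>\<sigma>\<close> with \<open>\<sigma> n = n\<close> avoid a positive
  power of \<open>X n\<close>. In their summands each remaining indeterminate has a positive
  exponent, and one factor of each is pulled out.\<close>

lemma truncate_alt_Suc_shift:
  assumes "g n = 0" "\<And>i. i < n \<Longrightarrow> 0 < g i"
  shows "truncate_vars n (alt (Suc n) g) = (\<Prod>i<n. X i) * alt n (\<lambda>i. g i - 1)"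
proof -
  define F where "F \<sigma> = of_int (sign \<sigma>) * (\<Prod>i<Suc n. (if \<sigma> i < n then X (\<sigma> i) else 0) ^ g i)" for \<sigma>
  have fixed: "\<sigma> permutes {..<n}" if "\<sigma> permutes {..<Suc n}" "\<sigma> n = n" for \<sigma>
    by (rule permutes_superset[OF that(1)]) (use that(2) in \<open>auto simp: less_Suc_eq\<close>)
  have "F \<sigma> = 0" if \<sigma>: "\<sigma> permutes {..<Suc n}" and "\<sigma> n \<noteq> n" for \<sigma>
  proof -
    obtain i where i: "\<sigma> i = n" "i < Suc n"
      using permutes_inverses(1)[OF \<sigma>, of n] permutes_in_image[OF permutes_inv[OF \<sigma>], of n] by auto
    with that have "i < n" by (cases "i = n") auto
    then have "(if \<sigma> i < n then X (\<sigma> i) else 0) ^ g i = 0"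
      using assms(2)[of i] i by (simp add: zero_power)
    then have "(\<Prod>i<Suc n. (if \<sigma> i < n then X (\<sigma> i) else 0) ^ g i) = 0"
      using i(2) by (intro prod_zero bexI[of _ i]) simp_all
    then show ?thesis by (simp only: F_def mult_zero_right)
  qed
  then have "truncate_vars n (alt (Suc n) g) = (\<Sum>\<sigma> | \<sigma> permutes {..<n}. F \<sigma>)"
    unfolding truncate_alt_Suc F_def [symmetric]
    by (intro sum.mono_neutral_right)
       (auto intro: fixed permutes_subset simp: finite_permutations)
  also have "\<dots> = (\<Sum>\<sigma> | \<sigma> permutes {..<n}.
      (\<Prod>i<n. X i) * (of_int (sign \<sigma>) * (\<Prod>i<n. X (\<sigma> i) ^ (g i - 1))))"
  proof (intro sum.cong refl)
    fix \<sigma> assume "\<sigma> \<in> {\<sigma>. \<sigma> permutes {..<n}}"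
    then have \<sigma>: "\<sigma> permutes {..<n}" by simp
    have "(\<Prod>i<Suc n. (if \<sigma> i < n then X (\<sigma> i) else 0) ^ g i) = (\<Prod>i<n. X (\<sigma> i) * X (\<sigma> i) ^ (g i - 1))"
    proof -
      have "(if \<sigma> i < n then X (\<sigma> i) else 0) ^ g i = X (\<sigma> i) * X (\<sigma> i) ^ (g i - 1)" if "i < n" for i
        using permutes_in_image[OF \<sigma>, of i] that assms(2)[OF that] by (cases "g i") auto
      \<comment> \<open>The factor for \<open>i = n\<close> is 0 to the power
        \<open>g n = 0\<close>, hence 1.\<close>
      then show ?thesis by (simp add: assms(1))
    qed
    also have "\<dots> = (\<Prod>i<n. X i) * (\<Prod>i<n. X (\<sigma> i) ^ (g i - 1))"
      using prod.permute[OF \<sigma>, of X] by (simp add: prod.distrib o_def)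
    finally show "F \<sigma> = (\<Prod>i<n. X i) * (of_int (sign \<sigma>) * (\<Prod>i<n. X (\<sigma> i) ^ (g i - 1)))"
      by (simp add: F_def ac_simps)
  qed
  finally show ?thesis
    by (simp only: alt_def sum_distrib_left)
qed

definition stair :: "nat \<Rightarrow> nat \<Rightarrow> nat" where
  "stair n i = n - 1 - i"

lemma lookup_staircase: "Poly_Mapping.lookup (staircase n) = stair n"
  by (auto simp: fun_eq_iff staircase_def stair_def lookup_sum lookup_single when_def)

text \<open>Setting the last indeterminate to zero leaves a product of indeterminates times the
  previous alternant, so nonvanishing is inherited without the Vandermonde product formula.\<close>

lemma alt_stair_nonzero: "alt n (stair n) \<noteq> 0"
proof (induction n)
  case 0
  then show ?case by (simp add: alt_def)
next
  case (Suc n)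
  have "truncate_vars n (alt (Suc n) (stair (Suc n))) =
      (\<Prod>i<n. X i) * alt n (\<lambda>i. stair (Suc n) i - 1)"
    by (rule truncate_alt_Suc_shift) (auto simp: stair_def)
  also have "alt n (\<lambda>i. stair (Suc n) i - 1) = alt n (stair n)"
    by (rule alt_cong) (auto simp: stair_def)
  also have "(\<Prod>i<n. X i) * alt n (stair n) \<noteq> 0"
    using Suc prod_X_nonzero[of "{..<n}"] by (simp add: polys_mult_eq_0_iff)
  finally have "truncate_vars n (alt (Suc n) (stair (Suc n))) \<noteq> truncate_vars n 0"
    by (simp only: truncate.hom_0 not_False_eq_True)
  then show ?case
    by (rule contrapos_nn) (rule arg_cong)
qed

subsection \<open>Division of alternants\<close>

text \<open>Exchange argument: \<open>S\<close> and \<open>{..<k}\<close> differ by equally many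
  elements, those only in \<open>S\<close> weighing at most \<open>n - k\<close> and those only in
  \<open>{..<k}\<close> at least \<open>n - k + 1\<close>. This makes \<open>{..<k}\<close> the
  unique leading strip in \<open>alt_divisible\<close>.\<close>

lemma sum_rev_less:
  fixes S :: "nat set"
  assumes S: "S \<subseteq> {..<n}" "card S = k" "S \<noteq> {..<k}"
  shows "(\<Sum>i\<in>S. n - i) < (\<Sum>i<k. n - i)"
proof -
  let ?A = "S - {..<k}" and ?B = "{..<k} - S"
  have fin: "finite S" using S(1) finite_subset by blast
  have kn: "k \<le> n" using card_mono[OF _ S(1)] S(2) by simp
  have card: "card ?A = card ?B"
    using S(2) card_Int_Diff[OF fin, of "{..<k}"] card_Int_Diff[of "{..<k}" S]
    by (simp add: Int_commute)
  have "?B \<noteq> {}"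
  proof
    assume "?B = {}"
    then have "{..<k} = S"
      using S(2) by (intro card_subset_eq[OF fin]) auto
    with S(3) show False by simp
  qed
  then have pos: "card ?B > 0" by (simp add: card_gt_0_iff)
  have "(\<Sum>i\<in>?A. n - i) \<le> card ?A * (n - k)"
    by (rule order_trans[OF sum_bounded_above[of ?A _ "n - k"]]) auto
  also have "\<dots> < card ?B * Suc (n - k)"
    using card pos by simp
  also have "\<dots> \<le> (\<Sum>i\<in>?B. n - i)"
    by (rule order_trans[OF _ sum_bounded_below[of ?B "Suc (n - k)"]]) (use kn in auto)
  finally have "(\<Sum>i\<in>?A. n - i) < (\<Sum>i\<in>?B. n - i)" .
  moreover have "(\<Sum>i\<in>S. n - i) = (\<Sum>i\<in>S \<inter> {..<k}. n - i) + (\<Sum>i\<in>?A. n - i)"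
    using sum.Int_Diff[OF fin] .
  moreover have "(\<Sum>i<k. n - i) = (\<Sum>i\<in>S \<inter> {..<k}. n - i) + (\<Sum>i\<in>?B. n - i)"
    using sum.Int_Diff[of "{..<k}" "\<lambda>i. n - i" S] by (simp add: Int_commute)
  ultimately show ?thesis by simp
qed

definition decreasing_below :: "nat \<Rightarrow> (nat \<Rightarrow> nat) \<Rightarrow> bool" where
  "decreasing_below n g \<longleftrightarrow> (\<forall>i j. i < j \<longrightarrow> j < n \<longrightarrow> g j < g i)"

lemma decreasing_below_gap:
  assumes "decreasing_below n g" "i \<le> j" "j < n"
  shows "g j + (j - i) \<le> g i"
  using assms(2,3)
proof (induction j rule: dec_induct)
  case (step j)
  have "g (Suc j) < g j" using assms(1) step.prems by (simp add: decreasing_below_def)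
  with step show ?case by simp
qed simp

lemma decreasing_below_ge:
  assumes "decreasing_below n g" "i < n"
  shows "stair n i \<le> g i"
proof -
  have "g (n - 1) + (n - 1 - i) \<le> g i"
    using assms(2) by (intro decreasing_below_gap[OF assms(1)]) auto
  then show ?thesis by (simp add: stair_def)
qed

lemma sum_of_bool_mult:
  assumes "S \<subseteq> {..<n :: nat}"
  shows "(\<Sum>i<n. f i * of_bool (i \<in> S)) = (\<Sum>i\<in>S. f i :: nat)"
proof -
  have "(\<Sum>i<n. f i * of_bool (i \<in> S)) = (\<Sum>i\<in>S. f i * of_bool (i \<in> S))"
    using assms by (intro sum.mono_neutral_right) auto
  then show ?thesis by simp
qed

text \<open>
  Adding a vertical strip to \<open>g\<close> through multiplication by an elementary symmetric function
  produces \<open>alt n g\<close> plus alternants of smaller weight \<open>\<Sum>i. (n - i) * g i\<close>.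
\<close>

lemma alt_divisible:
  assumes "decreasing_below n g"
  shows "\<exists>q\<in>polys. deg_le (\<Sum>i<n. g i - stair n i) q \<and> q * alt n (stair n) = alt n g"
  using assms
proof (induction "\<Sum>i<n. (n - i) * g i" arbitrary: g rule: less_induct)
  case less
  note dec = less.prems
  \<comment> \<open>The differences \<open>g i - stair n i\<close> form a partition;
    \<open>k\<close> is its number of nonzero parts. Below, \<open>g'\<close> removes the first
    column of this partition.\<close>
  define k where "k = (LEAST k. k \<ge> n \<or> g k \<le> stair n k)"
  have k: "k \<ge> n \<or> g k \<le> stair n k"
    unfolding k_def by (rule LeastI[of _ n]) simp
  have less_k: "i < n \<and> stair n i < g i" if "i < k" for i
    using not_less_Least[of i "\<lambda>k. k \<ge> n \<or> g k \<le> stair n k"] that unfolding k_def by auto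
  have kn: "k \<le> n" unfolding k_def by (rule Least_le) simp
  show ?case
  proof (cases "k = 0")
    case True
    have "g i = stair n i" if "i < n" for i
      using decreasing_below_gap[OF dec, of 0 i] decreasing_below_ge[OF dec that] k True that
      by (auto simp: stair_def)
    then have "alt n g = alt n (stair n)" by (rule alt_cong)
    then show ?thesis
      by (intro bexI[of _ 1] conjI) (use deg_le_1 in \<open>auto simp: deg_le_def\<close>)
  next
    case False
    define g' where "g' i = (if i < k then g i - 1 else g i)" for i
    define h where "h S i = g' i + of_bool (i \<in> S)" for S i
    define D where "D f = (\<Sum>i<n. f i - stair n i)" for f :: "nat \<Rightarrow> nat"
    define W where "W f = (\<Sum>i<n. (n - i) * f i)" for f :: "nat \<Rightarrow> nat"
    let ?B = "{S. S \<subseteq> {..<n} \<and> card S = k}"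
    let ?d = "stair n"
    have g_eq: "g = h {..<k}"
      using less_k by (force simp: fun_eq_iff h_def g'_def)
    have dec': "decreasing_below n g'"
      unfolding decreasing_below_def
    proof (intro allI impI)
      fix i j assume ij: "i < j" "j < n"
      have "g j < g i" using dec ij by (simp add: decreasing_below_def)
      \<comment> \<open>The only place where lowering could spoil strictness: for
        \<open>i < k \<le> j\<close>,
        \<open>g i - 1 \<ge> stair n i > stair n j \<ge> g j\<close>.\<close>
      moreover have "g j < g i - 1" if "i < k" "k \<le> j"
        using less_k[OF that(1)] k decreasing_below_gap[OF dec that(2)] that ij
        by (simp add: stair_def)
      ultimately show "g' j < g' i"
        using less_k[of i] less_k[of j] ij by (auto simp: g'_def)
    qed
    have W: "W (h S) = W g' + (\<Sum>i\<in>S. n - i)" if "S \<subseteq> {..<n}" for S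
      using sum_of_bool_mult[OF that, of "\<lambda>i. n - i"]
      by (simp add: W_def h_def distrib_left sum.distrib)
    have D: "D (h S) = D g' + card S" if "S \<subseteq> {..<n}" for S
    proof -
      have "D (h S) = (\<Sum>i<n. (g' i - ?d i) + 1 * of_bool (i \<in> S))"
        \<comment> \<open>\<open>g'\<close> dominates the staircase, so the natural number
          subtraction is exact.\<close>
        unfolding D_def h_def using decreasing_below_ge[OF dec'] by (intro sum.cong) auto
      then show ?thesis
        using sum_of_bool_mult[OF that, of "\<lambda>i. 1"] by (simp add: D_def sum.distrib)
    qed
    have k_in: "{..<k} \<in> ?B" using kn by auto
    then have Dg: "D g = D g' + k" and Wg: "W g = W g' + (\<Sum>i<k. n - i)"
      unfolding g_eq by (simp_all add: D W)
    have "(\<Sum>i<k. n - i) > 0"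
      using False kn by (intro sum_pos) auto
    then have "W g' < W g" by (simp add: Wg)
    then obtain q' where q': "q' \<in> polys" "deg_le (D g') q'" "q' * alt n ?d = alt n g'"
      using less.hyps[of g'] dec' unfolding W_def D_def by blast
    have "\<exists>q\<in>polys. deg_le (D g) q \<and> q * alt n ?d = alt n (h S)" if "S \<in> ?B - {{..<k}}" for S
    proof (cases "decreasing_below n (h S)")
      case True
      have "W (h S) < W g"
        using that W[of S] Wg sum_rev_less[of S n k] by auto
      moreover have "D (h S) = D g"
        using that D[of S] Dg by auto
      ultimately show ?thesis
        using less.hyps[of "h S"] True unfolding W_def D_def by auto
    next
      case False
      then obtain i j where ij: "i < j" "j < n" "\<not> h S j < h S i"
        unfolding decreasing_below_def by blast
      moreover have "g' j < g' i" using dec' ij by (simp add: decreasing_below_def)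
      \<comment> \<open>A strip raises an exponent by at most 1, so order in the strictly decreasing
        \<open>g'\<close> can be lost only through a tie.\<close>
      ultimately have "h S i = h S j" by (auto simp: h_def of_bool_def split: if_splits)
      then have "alt n (h S) = 0"
        using ij by (intro alt_eq_0[of i n j]) auto
      then show ?thesis
        by (intro bexI[of _ 0]) (auto simp: deg_le_def zero_mseries.rep_eq)
    qed
    then obtain q where q: "\<And>S. S \<in> ?B - {{..<k}} \<Longrightarrow>
        q S \<in> polys \<and> deg_le (D g) (q S) \<and> q S * alt n ?d = alt n (h S)"
      by metis
    \<comment> \<open>Solves the elementary rule for its leading term \<open>alt n g\<close>, which
      belongs to \<open>S = {..<k}\<close>.\<close>
    define r where "r = elementary n k * q' - (\<Sum>S\<in>?B - {{..<k}}. q S)"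
    have "r \<in> polys"
      unfolding r_def using q q'
      by (intro polys_diff polys_mult polys_sum elementary_in_polys) auto
    moreover have "deg_le (D g) r"
      unfolding r_def
    proof (intro deg_le_diff deg_le_sum)
      show "deg_le (D g) (elementary n k * q')"
        using deg_le_mult[OF deg_le_elementary q'(2)] by (simp add: Dg add.commute)
    qed (use q in auto)
    moreover have "r * alt n ?d = alt n g"
    proof -
      have fin: "finite ?B" by simp
      have "elementary n k * alt n g' = (\<Sum>S\<in>?B. alt n (h S))"
        unfolding elementary_mult_alt h_def ..
      also have "\<dots> = alt n g + (\<Sum>S\<in>?B - {{..<k}}. alt n (h S))"
        unfolding g_eq by (rule sum.remove[OF fin k_in])
      finally have *: "elementary n k * alt n g' = alt n g + (\<Sum>S\<in>?B - {{..<k}}. alt n (h S))" .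
      have "(\<Sum>S\<in>?B - {{..<k}}. q S * alt n ?d) = (\<Sum>S\<in>?B - {{..<k}}. alt n (h S))"
        by (rule sum.cong) (use q in auto)
      then show ?thesis
        unfolding r_def left_diff_distrib sum_distrib_right mult.assoc q'(3) * by simp
    qed
    ultimately show ?thesis
      unfolding D_def by blast
  qed
qed

subsection \<open>Existence of Schur functions\<close>

lemma decreasing_below_partition:
  assumes "is_partition \<nu>"
  shows "decreasing_below n (\<lambda>i. stair n i + Poly_Mapping.lookup \<nu> i)"
  unfolding decreasing_below_def
proof (intro allI impI)
  fix i j assume "i < j" "j < n"
  then show "stair n j + Poly_Mapping.lookup \<nu> j < stair n i + Poly_Mapping.lookup \<nu> i"
    using partition_antimono[OF assms, of i j] by (simp add: stair_def)
qed

text \<open>Resolves the definite description in \<open>schur_poly\<close>: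
  \<open>alt_divisible\<close> supplies a quotient, and the nonzero staircase alternant makes it
  unique.\<close>

lemma schur_poly_mult_alt:
  assumes "is_partition \<nu>" "\<nu> \<in> vecs n"
  shows "series_of_poly (schur_poly n \<nu>) * alt n (stair n) =
      alt n (\<lambda>i. stair n i + Poly_Mapping.lookup \<nu> i)"
    and "deg_le (csize \<nu>) (series_of_poly (schur_poly n \<nu>))"
proof -
  let ?d = "stair n"
  have den: "alt n ?d = series_of_poly (alternant n (staircase n))"
    unfolding alt_lookup [symmetric] by (rule alt_cong) (simp only: lookup_staircase)
  have num: "alt n (\<lambda>i. stair n i + Poly_Mapping.lookup \<nu> i) = series_of_poly (alternant n (staircase n + \<nu>))"
    unfolding alt_lookup [symmetric] by (rule alt_cong) (simp add: lookup_staircase lookup_add)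
  have nz: "alternant n (staircase n) \<noteq> 0"
    using alt_stair_nonzero[of n] by (simp only: den series_of_poly_eq_0_iff not_False_eq_True)
  have size: "(\<Sum>i<n. (stair n i + Poly_Mapping.lookup \<nu> i) - stair n i) = csize \<nu>"
    by (simp add: csize_eq_sum[OF assms(2)])
  obtain q where q: "q \<in> polys" "deg_le (csize \<nu>) q"
      "q * alt n (stair n) = alt n (\<lambda>i. stair n i + Poly_Mapping.lookup \<nu> i)"
    using alt_divisible[OF decreasing_below_partition[OF assms(1), of n]] unfolding size by blast
  then obtain p where p: "q = series_of_poly p" by (auto simp: polys_def)
  have "series_of_poly (p * alternant n (staircase n)) = series_of_poly (alternant n (staircase n + \<nu>))"
    using q(3) by (simp only: series_of_poly_mult p den num)
  then have eq: "p * alternant n (staircase n) = alternant n (staircase n + \<nu>)"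
    by (simp only: series_of_poly_inject)
  have "schur_poly n \<nu> = p"
    unfolding schur_poly_def if_P[OF assms(2)]
  proof (rule the_equality)
    fix r assume "r * alternant n (staircase n) = alternant n (staircase n + \<nu>)"
    then have "r * alternant n (staircase n) = p * alternant n (staircase n)"
      by (simp only: eq)
    then show "r = p" using mult_right_cancel[OF nz] by blast
  qed (rule eq)
  with q p show "series_of_poly (schur_poly n \<nu>) * alt n (stair n) =
      alt n (\<lambda>i. stair n i + Poly_Mapping.lookup \<nu> i)"
    "deg_le (csize \<nu>) (series_of_poly (schur_poly n \<nu>))"
    by simp_all
qed

lemma schur_poly_eqI:
  assumes "is_partition \<nu>" "\<nu> \<in> vecs n" "f \<in> polys"
    and "f * alt n (stair n) = alt n (\<lambda>i. stair n i + Poly_Mapping.lookup \<nu> i)"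
  shows "f = series_of_poly (schur_poly n \<nu>)"
  by (rule polys_cancel[OF assms(3) series_of_poly_in_polys alt_in_polys[of n] alt_stair_nonzero])
     (simp only: assms(4) schur_poly_mult_alt(1)[OF assms(1,2)])

lemma schur_poly_not_vecs: "\<nu> \<notin> vecs n \<Longrightarrow> schur_poly n \<nu> = 0"
  by (simp add: schur_poly_def)

lemma truncate_schur_poly_same:
  assumes "is_partition \<nu>"
  shows "truncate_vars n (series_of_poly (schur_poly n \<nu>)) = series_of_poly (schur_poly n \<nu>)"
proof (cases "\<nu> \<in> vecs n")
  case True
  let ?s = "series_of_poly (schur_poly n \<nu>)"
  have "truncate_vars n ?s * alt n (stair n) = truncate_vars n (?s * alt n (stair n))"
    by (simp only: truncate.hom_mult truncate_alt_same)
  also have "\<dots> = alt n (\<lambda>i. stair n i + Poly_Mapping.lookup \<nu> i)"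
    by (simp only: schur_poly_mult_alt(1)[OF assms True] truncate_alt_same)
  finally show ?thesis
    by (rule schur_poly_eqI[OF assms True truncate_in_polys[OF series_of_poly_in_polys]])
qed (simp add: schur_poly_not_vecs truncate.hom_0)

lemma permute_schur_poly:
  assumes "is_partition \<nu>" "\<pi> permutes {..<n}"
  shows "permute_vars \<pi> (series_of_poly (schur_poly n \<nu>)) = series_of_poly (schur_poly n \<nu>)"
proof -
  interpret mseries_hom "permute_vars \<pi>"
    using permutes_bij[OF assms(2)] by (rule mseries_hom_permute)
  show ?thesis
  proof (cases "\<nu> \<in> vecs n")
    case True
    let ?s = "series_of_poly (schur_poly n \<nu>)"
    let ?a = "alt n (stair n)"
    let ?b = "alt n (\<lambda>i. stair n i + Poly_Mapping.lookup \<nu> i)"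
    let ?e = "of_int (sign \<pi>) :: mseries"
    have "permute_vars \<pi> ?s * (?e * ?a) = ?e * ?b"
      using arg_cong[OF schur_poly_mult_alt(1)[OF assms(1) True], of "permute_vars \<pi>"]
      by (simp only: hom_mult permute_alt[OF assms(2)])
    then have "?e * (?e * (permute_vars \<pi> ?s * ?a)) = ?e * (?e * ?b)"
      by (simp only: mult.left_commute)
    then have "permute_vars \<pi> ?s * ?a = ?b"
      by (simp only: of_int_sign_square)
    then show ?thesis
      by (rule schur_poly_eqI[OF assms(1) True
            permute_in_polys[OF permutes_bij[OF assms(2)] series_of_poly_in_polys]])
  qed (simp add: schur_poly_not_vecs hom_0)
qed

text \<open>If part \<open>n\<close> of \<open>\<nu>\<close> is zero, both alternants lose the same
  factor \<open>\<Prod>i<n. X i\<close>, which cancels. Otherwise all exponents in the numerator are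
  positive and it vanishes, in accordance with \<open>schur_poly n \<nu> = 0\<close>.\<close>

lemma truncate_schur_poly_Suc:
  assumes "is_partition \<nu>"
  shows "truncate_vars n (series_of_poly (schur_poly (Suc n) \<nu>)) = series_of_poly (schur_poly n \<nu>)"
proof (cases "\<nu> \<in> vecs (Suc n)")
  case False
  then have "\<nu> \<notin> vecs n" by (metis le_Suc_eq order_refl vecs_mono)
  with False show ?thesis by (simp add: schur_poly_not_vecs truncate.hom_0)
next
  case Suc: True
  let ?t = "truncate_vars n (series_of_poly (schur_poly (Suc n) \<nu>))"
  let ?P = "\<Prod>i<n. X i"
  let ?l = "Poly_Mapping.lookup \<nu>"
  have t_poly: "?t \<in> polys" by (simp add: truncate_in_polys)
  have "truncate_vars n (alt (Suc n) (stair (Suc n))) = ?P * alt n (\<lambda>i. stair (Suc n) i - 1)"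
    by (rule truncate_alt_Suc_shift) (auto simp: stair_def)
  also have "alt n (\<lambda>i. stair (Suc n) i - 1) = alt n (stair n)"
    by (rule alt_cong) (auto simp: stair_def)
  finally have den: "truncate_vars n (alt (Suc n) (stair (Suc n))) = ?P * alt n (stair n)" .
  have eq: "?t * (?P * alt n (stair n)) = truncate_vars n (alt (Suc n) (\<lambda>i. stair (Suc n) i + ?l i))"
    unfolding den [symmetric] truncate.hom_mult [symmetric] schur_poly_mult_alt(1)[OF assms Suc] ..
  have P: "?P \<in> polys" "?P \<noteq> 0" using prod_X_nonzero[of "{..<n}"] by auto
  show ?thesis
  proof (cases "\<nu> \<in> vecs n")
    case True
    then have "?l n = 0" by (simp add: vecs_lookup_eq_0)
    then have "truncate_vars n (alt (Suc n) (\<lambda>i. stair (Suc n) i + ?l i)) =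
        ?P * alt n (\<lambda>i. stair (Suc n) i + ?l i - 1)"
      by (intro truncate_alt_Suc_shift) (auto simp: stair_def)
    moreover have "alt n (\<lambda>i. stair (Suc n) i + ?l i - 1) = alt n (\<lambda>i. stair n i + ?l i)"
      by (rule alt_cong) (auto simp: stair_def)
    ultimately have "?t * (?P * alt n (stair n)) = ?P * alt n (\<lambda>i. stair n i + ?l i)"
      using eq by (simp only:)
    then have "(?t * alt n (stair n)) * ?P = alt n (\<lambda>i. stair n i + ?l i) * ?P"
      by (simp only: ac_simps)
    then have "?t * alt n (stair n) = alt n (\<lambda>i. stair n i + ?l i)"
      by (rule polys_cancel[OF polys_mult[OF t_poly alt_in_polys] alt_in_polys P])
    then show ?thesis
      by (rule schur_poly_eqI[OF assms True t_poly])
  next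
    case False
    have "0 < ?l i" if "i \<le> n" for i
    proof -
      obtain j where "j \<ge> n" "?l j \<noteq> 0" using False by (auto simp: vecs_iff)
      with that show ?thesis using partition_antimono[OF assms, of i j] by linarith
    qed
    then have "truncate_vars n (alt (Suc n) (\<lambda>i. stair (Suc n) i + ?l i)) = 0"
      by (intro truncate_alt_Suc_eq_0) auto
    with eq have "?t * (?P * alt n (stair n)) = 0" by simp
    then have "?t = 0"
      using P alt_stair_nonzero[of n] polys_mult_eq_0_iff[OF t_poly polys_mult[OF P(1) alt_in_polys]]
        polys_mult_eq_0_iff[OF P(1) alt_in_polys, of n "stair n"] by blast
    with False show ?thesis by (simp add: schur_poly_not_vecs)
  qed
qed

lemma truncate_schur_poly:
  assumes "is_partition \<nu>" "n \<le> n'"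
  shows "truncate_vars n (series_of_poly (schur_poly n' \<nu>)) = series_of_poly (schur_poly n \<nu>)"
  using assms(2)
proof (induction n' rule: dec_induct)
  case base
  show ?case using assms(1) by (rule truncate_schur_poly_same)
next
  case (step n')
  have "truncate_vars n (series_of_poly (schur_poly (Suc n') \<nu>)) =
      truncate_vars n (truncate_vars n' (series_of_poly (schur_poly (Suc n') \<nu>)))"
    using step.hyps by (simp only: truncate_truncate)
  then show ?case
    by (simp only: truncate_schur_poly_Suc[OF assms(1)] step.IH)
qed

section \<open>Passage from Schur polynomials to Schur functions\<close>

text \<open>
  \<open>symmetric_series\<close> asks for invariance under all bijections of \<open>\<nat>\<close>; on a single monomial
  these act like permutations of finitely many indeterminates.
\<close>

lemma map_key_eq_permutes:
  fixes m :: composition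
  assumes \<sigma>: "bij \<sigma>" and m: "m \<in> vecs n" "Poly_Mapping.map_key \<sigma> m \<in> vecs n"
  obtains \<pi> where "\<pi> permutes {..<n}" "Poly_Mapping.map_key \<pi> m = Poly_Mapping.map_key \<sigma> m"
proof -
  let ?A = "Poly_Mapping.keys (Poly_Mapping.map_key \<sigma> m)" and ?B = "Poly_Mapping.keys m"
  have inj: "inj \<sigma>" using \<sigma> by (rule bij_is_inj)
  have A: "?A = \<sigma> -` ?B" using inj by (rule keys_map_key)
  then have img: "\<sigma> ` ?A = ?B" using \<sigma> by (simp add: bij_is_surj)
  have bij: "bij_betw \<sigma> ?A ?B"
    using img inj by (auto simp: bij_betw_def intro: inj_on_subset)
  have sub: "?A \<subseteq> {..<n}" "?B \<subseteq> {..<n}" using m by (auto simp: vecs_def)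
  have "card ({..<n} - ?A) = card ({..<n} - ?B)"
    using sub bij_betw_same_card[OF bij] by (simp add: card_Diff_subset)
  then obtain h where h: "bij_betw h ({..<n} - ?A) ({..<n} - ?B)"
    using finite_same_card_bij[of "{..<n} - ?A" "{..<n} - ?B"] by auto
  \<comment> \<open>On the support of the permuted monomial \<open>\<pi>\<close> agrees with
    \<open>\<sigma>\<close>. Elsewhere below \<open>n\<close> any bijection \<open>h\<close> of the
    complements will do, as the exponents there are zero on both sides.\<close>
  define \<pi> where "\<pi> i = (if i \<in> ?A then \<sigma> i else if i < n then h i else i)" for i
  have 1: "bij_betw \<pi> ?A ?B"
    using bij by (rule bij_betw_cong[THEN iffD1, rotated]) (simp add: \<pi>_def)
  have 2: "bij_betw \<pi> ({..<n} - ?A) ({..<n} - ?B)"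
    using h by (rule bij_betw_cong[THEN iffD1, rotated]) (simp add: \<pi>_def)
  have "bij_betw \<pi> (?A \<union> ({..<n} - ?A)) (?B \<union> ({..<n} - ?B))"
    using 1 2 by (rule bij_betw_combine) auto
  moreover have "?A \<union> ({..<n} - ?A) = {..<n}" "?B \<union> ({..<n} - ?B) = {..<n}"
    using sub by auto
  ultimately have "bij_betw \<pi> {..<n} {..<n}" by simp
  then have perm: "\<pi> permutes {..<n}"
    by (rule bij_imp_permutes) (use sub in \<open>auto simp: \<pi>_def\<close>)
  moreover have "Poly_Mapping.map_key \<pi> m = Poly_Mapping.map_key \<sigma> m"
  proof (rule poly_mapping_eqI)
    fix i
    have "Poly_Mapping.lookup m (\<pi> i) = Poly_Mapping.lookup m (\<sigma> i)"
    proof (cases "i \<in> ?A")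
      case False
      have "\<pi> i \<notin> ?B"
      proof (cases "i < n")
        case True
        then show ?thesis using bij_betwE[OF 2] False by auto
      next
        case nl: False
        then show ?thesis using False sub by (auto simp: \<pi>_def)
      qed
      moreover have "\<sigma> i \<notin> ?B" using False A by auto
      ultimately show ?thesis by (simp add: in_keys_iff)
    qed (simp add: \<pi>_def)
    then show "Poly_Mapping.lookup (Poly_Mapping.map_key \<pi> m) i =
        Poly_Mapping.lookup (Poly_Mapping.map_key \<sigma> m) i"
      by (simp add: lookup_map_key inj permutes_inj[OF perm])
  qed
  ultimately show thesis by (rule that)
qed

lemma truncations_determine:
  assumes "\<And>n. n \<ge> N \<Longrightarrow> truncate_vars n f = truncate_vars n g"
  shows "f = g"
proof (rule mseries_eqI)
  fix m
  obtain n where n: "m \<in> vecs n" "N \<le> n" using ex_vecs by blast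
  then have "mcoeff (truncate_vars n f) m = mcoeff (truncate_vars n g) m"
    by (simp only: assms)
  with n show "mcoeff f m = mcoeff g m" by simp
qed

lemma mcoeff_schur_poly_mono:
  assumes "is_partition \<nu>" "m \<in> vecs n" "n \<le> n'"
  shows "mcoeff (series_of_poly (schur_poly n' \<nu>)) m = mcoeff (series_of_poly (schur_poly n \<nu>)) m"
  by (simp only: truncate_schur_poly[OF assms(1,3), symmetric] mcoeff_truncate assms(2) if_True)

lemma truncate_schur:
  assumes \<nu>: "is_partition \<nu>"
  shows "truncate_vars n (schur \<nu>) = series_of_poly (schur_poly n \<nu>)"
proof -
  let ?s = "\<lambda>n. series_of_poly (schur_poly n \<nu>)"
  \<comment> \<open>The limit of the Schur polynomials: the coefficient of \<open>m\<close> is read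
    off in any number of indeterminates containing \<open>m\<close>, and compatibility under
    truncation makes the choice irrelevant.\<close>
  define f where "f = Abs_mseries (\<lambda>m. mcoeff (?s (SOME n. m \<in> vecs n)) m)"
  have coeff: "mcoeff f m = mcoeff (?s n) m" if n: "m \<in> vecs n" for m n
  proof -
    define n' where "n' = (SOME n. m \<in> vecs n)"
    have n': "m \<in> vecs n'" unfolding n'_def using n by (rule someI)
    have "mcoeff (?s n') m = mcoeff (?s n) m"
      using mcoeff_schur_poly_mono[OF \<nu> n', of n] mcoeff_schur_poly_mono[OF \<nu> n, of n']
        linear[of n n'] by argo
    then show ?thesis unfolding f_def n'_def by (simp only: Abs_mseries_coeff)
  qed
  have trunc: "truncate_vars n f = ?s n" for n
  proof (rule mseries_eqI)
    fix m
    have "mcoeff (truncate_vars n f) m = mcoeff (truncate_vars n (?s n)) m"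
      using coeff[of m n] by (simp only: mcoeff_truncate cong: if_cong)
    then show "mcoeff (truncate_vars n f) m = mcoeff (?s n) m"
      by (simp only: truncate_schur_poly_same[OF \<nu>])
  qed
  have "symmetric_series f"
    unfolding symmetric_series_def
  proof (intro allI impI)
    fix \<sigma> :: "nat \<Rightarrow> nat" and m :: composition assume \<sigma>: "bij \<sigma>"
    let ?m = "Poly_Mapping.map_key \<sigma> m"
    obtain n0 where "m \<in> vecs n0" using ex_vecs by blast
    moreover obtain n where n: "?m \<in> vecs n" "n0 \<le> n" using ex_vecs by blast
    ultimately have m: "m \<in> vecs n" using vecs_mono by blast
    obtain \<pi> where \<pi>: "\<pi> permutes {..<n}" "Poly_Mapping.map_key \<pi> m = ?m"
      using map_key_eq_permutes[OF \<sigma> m n(1)] by blast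
    have "mcoeff f ?m = mcoeff (permute_vars \<pi> (?s n)) m"
      using coeff[OF n(1)] \<pi>(2) by simp
    also have "\<dots> = mcoeff f m"
      unfolding permute_schur_poly[OF \<nu> \<pi>(1)] using coeff[OF m] by (rule sym)
    finally show "mcoeff f ?m = mcoeff f m" .
  qed
  moreover have "bounded_degree f"
    unfolding bounded_degree_def
  proof (intro exI allI impI)
    fix m assume nz: "mcoeff f m \<noteq> 0"
    obtain n where "m \<in> vecs n" using ex_vecs by blast
    then have nz': "mcoeff (?s n) m \<noteq> 0" using nz coeff[of m n] by simp
    then have "\<nu> \<in> vecs n" by (rule contrapos_np) (simp add: schur_poly_not_vecs zero_mseries.rep_eq)
    from schur_poly_mult_alt(2)[OF \<nu> this] nz' show "csize m \<le> csize \<nu>"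
      unfolding deg_le_def by blast
  qed
  ultimately have f: "f \<in> sym_funs \<and> (\<forall>n. truncate_vars n f = ?s n)"
    using trunc by (simp add: sym_funs_def)
  have "schur \<nu> = f"
    unfolding schur_def
  proof (rule the_equality)
    fix f' assume "f' \<in> sym_funs \<and> (\<forall>n. truncate_vars n f' = ?s n)"
    then have "truncate_vars n f' = truncate_vars n f" for n by (simp only: trunc)
    then show "f' = f" by (rule truncations_determine)
  qed (rule f)
  with trunc show ?thesis by simp
qed

subsection \<open>Adding a ribbon\<close>

text \<open>A nonzero part in row \<open>i \<ge> M\<close> would force \<open>i + 1\<close> parts of
  size at least 1, with sum above \<open>M\<close>.\<close>

lemma partitions_subset_vecs:
  assumes "\<nu> \<in> partitions M"
  shows "\<nu> \<in> vecs M"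
  unfolding vecs_iff
proof (intro allI impI)
  fix i assume i: "M \<le> i"
  have part: "is_partition \<nu>" and size: "csize \<nu> = M"
    using assms by (auto simp: partitions_def)
  obtain n where n: "\<nu> \<in> vecs n" "Suc i \<le> n" using ex_vecs by blast
  show "Poly_Mapping.lookup \<nu> i = 0"
  proof (rule ccontr)
    assume nz: "Poly_Mapping.lookup \<nu> i \<noteq> 0"
    have "Suc i = (\<Sum>l<Suc i. 1)" by simp
    also have "\<dots> \<le> (\<Sum>l<Suc i. Poly_Mapping.lookup \<nu> l)"
    proof (rule sum_mono)
      fix l assume "l \<in> {..<Suc i}"
      then show "1 \<le> Poly_Mapping.lookup \<nu> l"
        using partition_antimono[OF part, of l i] nz by simp
    qed
    also have "\<dots> \<le> (\<Sum>l<n. Poly_Mapping.lookup \<nu> l)"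
      using n(2) by (intro sum_mono2) auto
    also have "\<dots> = M"
      using csize_eq_sum[OF n(1)] size by simp
    finally show False using i by simp
  qed
qed

lemma finite_partitions: "finite (partitions M)"
proof -
  define F where "F = {f. \<forall>i. (i \<in> {..<M} \<longrightarrow> f i \<in> {..M}) \<and> (i \<notin> {..<M} \<longrightarrow> f i = (0::nat))}"
  have "finite F"
    unfolding F_def by (rule finite_set_of_finite_funs) auto
  moreover have "Poly_Mapping.lookup ` partitions M \<subseteq> F"
  proof
    fix f assume "f \<in> Poly_Mapping.lookup ` partitions M"
    then obtain \<nu> where \<nu>: "\<nu> \<in> partitions M" "f = Poly_Mapping.lookup \<nu>" by blast
    then have "f i \<le> M" for i
      using lookup_le_csize[of \<nu> i] by (simp add: partitions_def)
    moreover have "f i = 0" if "M \<le> i" for i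
      using vecs_lookup_eq_0[OF partitions_subset_vecs[OF \<nu>(1)] that] \<nu>(2) by simp
    ultimately show "f \<in> F" by (auto simp: F_def)
  qed
  ultimately have "finite (Poly_Mapping.lookup ` partitions M)" by (rule rev_finite_subset)
  moreover have "inj_on Poly_Mapping.lookup (partitions M)"
    by (rule inj_onI) (simp add: poly_mapping_eqI)
  ultimately show ?thesis by (rule finite_imageD)
qed

text \<open>The cycle on \<open>j, ..., i\<close> carrying position \<open>i\<close> to
  \<open>j\<close> and pushing each position it passes down by one.\<close>

definition cycle_down :: "nat \<Rightarrow> nat \<Rightarrow> nat \<Rightarrow> nat" where
  "cycle_down j i l = (if l = i then j else if j \<le> l \<and> l < i then Suc l else l)"

lemma cycle_down_permutes_sign:
  assumes "j \<le> i" "i < n"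
  shows "cycle_down j i permutes {..<n} \<and> sign (cycle_down j i) = (- 1) ^ (i - j)"
  using assms
proof (induction i rule: dec_induct)
  case base
  have id: "cycle_down j j = id" by (auto simp: cycle_down_def)
  show ?case unfolding id by (intro conjI permutes_id) simp
next
  case (step i)
  \<comment> \<open>Each additional position costs one adjacent transposition.\<close>
  have eq: "cycle_down j (Suc i) = cycle_down j i \<circ> transpose i (Suc i)"
    using step.hyps(1) by (auto simp: fun_eq_iff cycle_down_def transpose_def)
  have t: "transpose i (Suc i) permutes {..<n}"
    using step.prems by (intro permutes_swap_id) auto
  have IH: "cycle_down j i permutes {..<n}" "sign (cycle_down j i) = (- 1) ^ (i - j)"
    using step by auto
  have "sign (cycle_down j (Suc i)) = (- 1) ^ (i - j) * (- 1)"
    unfolding eq sign_compose_permutes[OF IH(1) t] IH(2) by (simp add: sign_swap_id)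
  also have "\<dots> = (- 1) ^ (Suc i - j)"
    using step.hyps(1) by (simp add: Suc_diff_le)
  finally have "sign (cycle_down j (Suc i)) = (- 1) ^ (Suc i - j)" .
  moreover have "cycle_down j (Suc i) permutes {..<n}"
    unfolding eq by (rule permutes_compose[OF t IH(1)])
  ultimately show ?case by blast
qed

section \<open>Ribbons as intervals of diagonals\<close>

text \<open>The diagonal of the first square outside row \<open>l\<close> of \<open>\<nu>\<close>.\<close>

definition edge :: "composition \<Rightarrow> nat \<Rightarrow> int" where
  "edge \<nu> l = int (Poly_Mapping.lookup \<nu> l) - int l"

lemma edge_less:
  assumes "is_partition \<nu>" "i < j"
  shows "edge \<nu> j < edge \<nu> i"
  using partition_antimono[OF assms(1), of i j] assms(2) by (simp add: edge_def)

lemma edge_le: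
  assumes "is_partition \<nu>" "i \<le> j"
  shows "edge \<nu> j \<le> edge \<nu> i"
  using edge_less[OF assms(1), of i j] assms(2) by (cases "i = j") auto

lemma skew_diagonal_iff:
  "(l, x) \<in> skew_diagram \<mu> \<nu> \<inter> diagonal e \<longleftrightarrow>
    int x = e + int l \<and> edge \<mu> l \<le> e \<and> e < edge \<nu> l"
  by (auto simp: skew_diagram_def diagram_def diagonal_def edge_def)

text \<open>A row meets a diagonal in at most one square, whose column is determined by row and
  diagonal. Squares can thus be replaced by row indices and a ribbon by a family of integer
  intervals.\<close>

lemma ribbon_from_iff:
  "ribbon_from d k \<mu> \<nu> \<longleftrightarrow> skew_shape \<mu> \<nu> \<and> skew_size \<mu> \<nu> = k \<and>
    (\<forall>l e. edge \<mu> l \<le> e \<longrightarrow> e < edge \<nu> l \<longrightarrow> e \<in> {d..<d + int k}) \<and>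
    (\<forall>e\<in>{d..<d + int k}. \<exists>!l. edge \<mu> l \<le> e \<and> e < edge \<nu> l)"
proof -
  have sq: "\<exists>x. (l, x) \<in> skew_diagram \<mu> \<nu> \<inter> diagonal e" if "edge \<mu> l \<le> e" "e < edge \<nu> l" for l e
    unfolding skew_diagonal_iff using that
    by (intro exI[of _ "nat (e + int l)"]) (simp add: edge_def)
  have "skew_diagram \<mu> \<nu> \<subseteq> (\<Union>e\<in>{d..<d + int k}. diagonal e) \<longleftrightarrow>
      (\<forall>l e. edge \<mu> l \<le> e \<longrightarrow> e < edge \<nu> l \<longrightarrow> e \<in> {d..<d + int k})" (is "?A \<longleftrightarrow> ?B")
  proof
    assume A: ?A
    show ?B
    proof (intro allI impI)
      fix l e assume "edge \<mu> l \<le> e" "e < edge \<nu> l"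
      then obtain x where x: "(l, x) \<in> skew_diagram \<mu> \<nu>" "(l, x) \<in> diagonal e"
        using sq[of l e] by auto
      with A obtain e' where "e' \<in> {d..<d + int k}" "(l, x) \<in> diagonal e'" by auto
      with x show "e \<in> {d..<d + int k}" by (auto simp: diagonal_def)
    qed
  next
    assume B: ?B
    show ?A
    proof (rule subsetI)
      fix s assume s: "s \<in> skew_diagram \<mu> \<nu>"
      obtain l x where lx: "s = (l, x)" by fastforce
      have diag: "(l, x) \<in> diagonal (int x - int l)" by (simp add: diagonal_def)
      then have "edge \<mu> l \<le> int x - int l" "int x - int l < edge \<nu> l"
        using s lx skew_diagonal_iff[of l x \<mu> \<nu> "int x - int l"] by auto
      then have "int x - int l \<in> {d..<d + int k}" using B by blast
      with diag lx show "s \<in> (\<Union>e\<in>{d..<d + int k}. diagonal e)" by blast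
    qed
  qed
  moreover have "(\<exists>!s. s \<in> skew_diagram \<mu> \<nu> \<inter> diagonal e) \<longleftrightarrow> (\<exists>!l. edge \<mu> l \<le> e \<and> e < edge \<nu> l)" for e
  proof
    assume ex: "\<exists>!s. s \<in> skew_diagram \<mu> \<nu> \<inter> diagonal e"
    then obtain l x where lx: "(l, x) \<in> skew_diagram \<mu> \<nu> \<inter> diagonal e" by (metis surj_pair)
    show "\<exists>!l. edge \<mu> l \<le> e \<and> e < edge \<nu> l"
    proof (rule ex1I[of _ l])
      show "edge \<mu> l \<le> e \<and> e < edge \<nu> l" using lx skew_diagonal_iff by blast
      fix l' assume "edge \<mu> l' \<le> e \<and> e < edge \<nu> l'"
      then obtain x' where "(l', x') \<in> skew_diagram \<mu> \<nu> \<inter> diagonal e" using sq by blast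
      with ex lx have "(l', x') = (l, x)" by blast
      then show "l' = l" by simp
    qed
  next
    assume ex: "\<exists>!l. edge \<mu> l \<le> e \<and> e < edge \<nu> l"
    then obtain l where "edge \<mu> l \<le> e" "e < edge \<nu> l" by blast
    then obtain x where lx: "(l, x) \<in> skew_diagram \<mu> \<nu> \<inter> diagonal e" using sq by blast
    show "\<exists>!s. s \<in> skew_diagram \<mu> \<nu> \<inter> diagonal e"
    proof (rule ex1I[of _ "(l, x)"])
      show "(l, x) \<in> skew_diagram \<mu> \<nu> \<inter> diagonal e" by (rule lx)
      fix s assume s: "s \<in> skew_diagram \<mu> \<nu> \<inter> diagonal e"
      obtain l' x' where s': "s = (l', x')" by fastforce
      have "int x = e + int l" "int x' = e + int l'" "l' = l"
        using s lx ex unfolding s' skew_diagonal_iff by blast+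
      then show "s = (l, x)" by (simp add: s')
    qed
  qed
  ultimately show ?thesis
    unfolding ribbon_from_def by simp
qed

lemma row_on_eq:
  assumes "\<exists>!l. edge \<mu> l \<le> e \<and> e < edge \<nu> l" "edge \<mu> l \<le> e" "e < edge \<nu> l"
  shows "row_on \<mu> \<nu> e = l"
proof -
  have "(THE s. s \<in> skew_diagram \<mu> \<nu> \<inter> diagonal e) = (l, nat (e + int l))"
  proof (rule the_equality)
    show "(l, nat (e + int l)) \<in> skew_diagram \<mu> \<nu> \<inter> diagonal e"
      unfolding skew_diagonal_iff using assms(2,3) by (simp add: edge_def)
    fix s assume s: "s \<in> skew_diagram \<mu> \<nu> \<inter> diagonal e"
    obtain l' x' where s': "s = (l', x')" by fastforce
    have "int x' = e + int l'" "l' = l"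
      using s assms unfolding s' skew_diagonal_iff by blast+
    then show "s = (l, nat (e + int l))" by (simp add: s' flip: nat_int)
  qed
  then show ?thesis by (simp add: row_on_def)
qed

text \<open>Compare row by row from the top. If row \<open>l\<close> is the first to differ and is
  longer in \<open>\<nu>'\<close>, its last diagonal must be met in \<open>\<nu>\<close> by another
  row, necessarily a higher one. There both shapes agree, so \<open>\<nu>'\<close> would meet that
  diagonal twice.\<close>

lemma ribbon_from_inject:
  assumes "ribbon_from d k \<mu> \<nu>" "ribbon_from d k \<mu> \<nu>'"
  shows "\<nu> = \<nu>'"
proof -
  have le: "Poly_Mapping.lookup \<nu>' l \<le> Poly_Mapping.lookup \<nu> l"
    if \<nu>: "ribbon_from d k \<mu> \<nu>" and \<nu>': "ribbon_from d k \<mu> \<nu>'"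
      and IH: "\<And>r. r < l \<Longrightarrow> Poly_Mapping.lookup \<nu> r = Poly_Mapping.lookup \<nu>' r"
    for \<nu> \<nu>' l
  proof (rule ccontr)
    assume "\<not> ?thesis"
    then have less: "edge \<nu> l < edge \<nu>' l" by (simp add: edge_def)
    define e where "e = edge \<nu>' l - 1"
    have part: "is_partition \<nu>" and sub: "edge \<mu> l \<le> edge \<nu> l"
      using \<nu> by (auto simp: ribbon_from_def skew_shape_def edge_def)
    have e: "edge \<mu> l \<le> e" "e < edge \<nu>' l" "edge \<nu> l \<le> e"
      using less sub by (auto simp: e_def)
    then have "e \<in> {d..<d + int k}" using \<nu>' unfolding ribbon_from_iff by blast
    then obtain r where r: "edge \<mu> r \<le> e" "e < edge \<nu> r"
        and unique: "\<exists>!l. edge \<mu> l \<le> e \<and> e < edge \<nu>' l"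
      using \<nu> \<nu>' unfolding ribbon_from_iff by blast
    have "r < l" using edge_le[OF part, of l r] e(3) r(2) by (cases "r < l") auto
    moreover from this have "e < edge \<nu>' r" using r(2) IH by (simp add: edge_def)
    ultimately show False using unique r(1) e(1,2) by blast
  qed
  have "Poly_Mapping.lookup \<nu> l = Poly_Mapping.lookup \<nu>' l" for l
  proof (induction l rule: less_induct)
    case (less l)
    then show ?case
      using le[OF assms, of l] le[OF assms(2,1), of l] by fastforce
  qed
  then show ?thesis by (rule poly_mapping_eqI)
qed

text \<open>The row meeting the first diagonal \<open>d\<close> cannot meet \<open>d - 1\<close>, so
  it starts at \<open>d\<close>. If \<open>edge \<mu> j\<close> were \<open>d + k\<close>, row
  \<open>j\<close> would lie above the row ending the ribbon, hence reach further in
  \<open>\<nu>\<close> and put a square on \<open>d + k\<close>. Thus every ribbon comes from a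
  raised exponent that is not repeated.\<close>

lemma ribbon_from_start:
  assumes rib: "ribbon_from d k \<mu> \<nu>" and k: "k > 0"
  obtains i where "d = edge \<mu> i" "edge \<mu> i < edge \<nu> i" "\<And>l. edge \<mu> l \<noteq> edge \<mu> i + int k"
proof -
  have part: "is_partition \<mu>" "is_partition \<nu>" and sub: "edge \<mu> l \<le> edge \<nu> l" for l
    using rib by (auto simp: ribbon_from_def skew_shape_def edge_def)
  have inside: "e \<in> {d..<d + int k}" if "edge \<mu> l \<le> e" "e < edge \<nu> l" for l e
    using rib that unfolding ribbon_from_iff by blast
  have ex: "\<exists>l. edge \<mu> l \<le> e \<and> e < edge \<nu> l" if "e \<in> {d..<d + int k}" for e
    using rib that unfolding ribbon_from_iff by blast
  obtain i where i: "edge \<mu> i \<le> d" "d < edge \<nu> i" using ex[of d] k by auto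
  then have d: "d = edge \<mu> i" using inside[of i "d - 1"] by force
  moreover have "edge \<mu> j \<noteq> edge \<mu> i + int k" for j
  proof
    assume j: "edge \<mu> j = edge \<mu> i + int k"
    obtain l where l: "edge \<mu> l \<le> d + int k - 1" "d + int k - 1 < edge \<nu> l"
      using ex[of "d + int k - 1"] k by auto
    have "edge \<nu> l = d + int k" using inside[of l "d + int k"] l by force
    moreover have "j < l"
      using edge_le[OF part(1), of l j] l(1) j d by (cases "j < l") auto
    ultimately have "edge \<mu> j < edge \<nu> j"
      using edge_less[OF part(2), of j l] j d by simp
    then show False using inside[of j "edge \<mu> j"] j d by simp
  qed
  ultimately show thesis using i that by blast
qed

text \<open>
  Row \<open>i\<close> contains the first square of the ribbon and row \<open>j\<close> the last one; the edges of the
  rows in between move down by one row.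
\<close>

locale ribbon_addition =
  fixes \<mu> :: composition and k i j :: nat
  assumes part: "is_partition \<mu>" and k: "k > 0" and ji: "j \<le> i"
    and upper: "\<And>l. l < j \<Longrightarrow> edge \<mu> i + int k < edge \<mu> l"
    and lower: "edge \<mu> j < edge \<mu> i + int k"
begin

text \<open>The permuted edges converted back to parts: an edge moved down one row gains 1 as a
  part. The subtraction in row \<open>j\<close> is exact by \<open>lower\<close>.\<close>

definition row :: "nat \<Rightarrow> nat" where
  "row l = (if l = j then Poly_Mapping.lookup \<mu> i + k + j - i
            else if j < l \<and> l \<le> i then Suc (Poly_Mapping.lookup \<mu> (l - 1))
            else Poly_Mapping.lookup \<mu> l)"

definition extended :: composition where
  "extended = Abs_poly_mapping row"

lemma lookup_extended: "Poly_Mapping.lookup extended = row"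
proof -
  have "{l. row l \<noteq> 0} \<subseteq> {..i} \<union> Poly_Mapping.keys \<mu>"
    using ji by (auto simp: row_def in_keys_iff split: if_splits)
  then have "finite {l. row l \<noteq> 0}"
    by (rule finite_subset) simp
  then show ?thesis by (simp add: extended_def)
qed

lemma edge_extended:
  "edge extended l = (if l = j then edge \<mu> i + int k else if j < l \<and> l \<le> i then edge \<mu> (l - 1) else edge \<mu> l)"
  using lower by (auto simp: edge_def lookup_extended row_def of_nat_diff)

lemma edge_extended_mono: "edge \<mu> l \<le> edge extended l"
  using lower edge_le[OF part, of "l - 1" l] by (auto simp: edge_extended)

lemma edge_extended_less: "edge extended (Suc l) < edge extended l"
proof -
  consider "Suc l < j" | "Suc l = j" | "l = j" "l < i" | "j < l" "l < i" | "l = i" | "i < l"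
    using ji by linarith
  then show ?thesis
  proof cases
    \<comment> \<open>The row where the ribbon starts; passing through
      \<open>edge_extended_mono\<close> treats \<open>j = i\<close> and \<open>j < i\<close>
      together.\<close>
    case 5
    then have "edge extended (Suc l) = edge \<mu> (Suc l)" using ji by (simp add: edge_extended)
    also have "\<dots> < edge \<mu> l" using part by (rule edge_less) simp
    also have "\<dots> \<le> edge extended l" by (rule edge_extended_mono)
    finally show ?thesis .
  qed (use ji lower upper[of l] edge_less[OF part, of l "Suc l"] edge_less[OF part, of "l - 1" l]
      in \<open>auto simp: edge_extended\<close>)
qed

lemma is_partition_extended: "is_partition extended"
  unfolding is_partition_def
proof
  fix l
  show "Poly_Mapping.lookup extended (Suc l) \<le> Poly_Mapping.lookup extended l"
    using edge_extended_less[of l] by (simp add: edge_def)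
qed

text \<open>Exponents are edges shifted by \<open>n - 1\<close>, so this is
  \<open>edge_extended\<close> read along the cycle.\<close>

lemma stair_extended:
  assumes "i < n"
  shows "l < n \<Longrightarrow> stair n (cycle_down j i l) + Poly_Mapping.lookup extended (cycle_down j i l) =
    stair n l + Poly_Mapping.lookup \<mu> l + (if l = i then k else 0)"
proof -
  assume l: "l < n"
  have eq: "int (stair n r + Poly_Mapping.lookup \<nu> r) = int n - 1 + edge \<nu> r" if "r < n" for r \<nu>
    using that by (simp add: stair_def edge_def of_nat_diff)
  have r: "cycle_down j i l < n"
    using l ji assms by (auto simp: cycle_down_def)
  have "edge extended (cycle_down j i l) = edge \<mu> l + (if l = i then int k else 0)"
    using ji by (auto simp: cycle_down_def edge_extended)
  then have "int (stair n (cycle_down j i l) + Poly_Mapping.lookup extended (cycle_down j i l)) =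
      int (stair n l + Poly_Mapping.lookup \<mu> l) + (if l = i then int k else 0)"
    unfolding eq[OF r] eq[OF l] by simp
  then show ?thesis by (cases "l = i") simp_all
qed

text \<open>\<open>stair_extended\<close> summed over the rows: the cycle only reorders the sum, and
  the staircases cancel.\<close>

lemma csize_extended: "csize extended = csize \<mu> + k"
proof -
  let ?c = "cycle_down j i"
  obtain n1 where n1: "extended \<in> vecs n1" "Suc i \<le> n1" using ex_vecs by blast
  obtain n where n: "\<mu> \<in> vecs n" "n1 \<le> n" using ex_vecs by blast
  have in_vecs: "extended \<in> vecs n" using n1(1) n(2) by (rule vecs_mono)
  have i: "i < n" using n1 n by simp
  have c: "?c permutes {..<n}" using cycle_down_permutes_sign[OF ji i] by blast
  have "(\<Sum>l<n. stair n l + Poly_Mapping.lookup extended l) =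
      (\<Sum>l<n. stair n (?c l) + Poly_Mapping.lookup extended (?c l))"
    using sum.permute[OF c, of "\<lambda>l. stair n l + Poly_Mapping.lookup extended l"] by (simp only: o_def)
  also have "\<dots> = (\<Sum>l<n. stair n l + Poly_Mapping.lookup \<mu> l + (if l = i then k else 0))"
    by (intro sum.cong refl stair_extended[OF i]) simp
  finally have "(\<Sum>l<n. Poly_Mapping.lookup extended l) = (\<Sum>l<n. Poly_Mapping.lookup \<mu> l) + k"
    using i by (simp add: sum.distrib)
  then show ?thesis
    by (simp only: csize_eq_sum[OF in_vecs] csize_eq_sum[OF n(1)])
qed

text \<open>For \<open>j < l \<le> i\<close> row \<open>l\<close> ends where row
  \<open>l - 1\<close> of \<open>\<mu>\<close> did, so the intervals of rows
  \<open>i, ..., j\<close> abut and tile the range from \<open>edge \<mu> i\<close> up to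
  \<open>edge \<mu> i + k\<close>. The row meeting \<open>e\<close> is the first one with
  \<open>edge \<mu> l \<le> e\<close>.\<close>

lemma unique_row:
  assumes e: "e \<in> {edge \<mu> i..<edge \<mu> i + int k}"
  shows "\<exists>!l. edge \<mu> l \<le> e \<and> e < edge extended l"
proof (rule ex_ex1I)
  define l where "l = (LEAST l. edge \<mu> l \<le> e)"
  have l: "edge \<mu> l \<le> e" unfolding l_def by (rule LeastI[of _ i]) (use e in simp)
  have li: "l \<le> i" unfolding l_def by (rule Least_le) (use e in simp)
  have jl: "j \<le> l"
    using upper[of l] l e by (cases "j \<le> l") auto
  have "e < edge extended l"
  proof (cases "l = j")
    case True
    then show ?thesis using e by (simp add: edge_extended)
  next
    case False
    then have "\<not> edge \<mu> (l - 1) \<le> e"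
      using jl unfolding l_def by (intro not_less_Least) auto
    then show ?thesis using False jl li by (simp add: edge_extended)
  qed
  with l show "\<exists>l. edge \<mu> l \<le> e \<and> e < edge extended l" by blast
next
  have *: False if "l < l'" "edge \<mu> l \<le> e" "edge \<mu> l' \<le> e" "e < edge extended l'" for l l'
  proof -
    have "j \<le> l"
      using upper[of l] that(2) e by (cases "j \<le> l") auto
    moreover have "edge \<mu> (l' - 1) \<le> edge \<mu> l"
      using that(1) by (intro edge_le part) auto
    ultimately show False
      using that by (auto simp: edge_extended split: if_splits)
  qed
  fix l l' assume "edge \<mu> l \<le> e \<and> e < edge extended l" "edge \<mu> l' \<le> e \<and> e < edge extended l'"
  then show "l = l'"
    using *[of l l'] *[of l' l] by (cases l l' rule: linorder_cases) auto
qed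

lemma ribbon_from_extended: "ribbon_from (edge \<mu> i) k \<mu> extended"
  unfolding ribbon_from_iff
proof (intro conjI allI impI ballI)
  show "skew_shape \<mu> extended"
    using part is_partition_extended edge_extended_mono by (auto simp: skew_shape_def edge_def)
  show "skew_size \<mu> extended = k"
    by (simp add: skew_size_def csize_extended)
  show "\<exists>!l. edge \<mu> l \<le> e \<and> e < edge extended l" if "e \<in> {edge \<mu> i..<edge \<mu> i + int k}" for e
    using that by (rule unique_row)
  fix l e assume le: "edge \<mu> l \<le> e" "e < edge extended l"
  then have l: "j \<le> l" "l \<le> i"
    using ji by (auto simp: edge_extended split: if_splits)
  have "edge extended l \<le> edge \<mu> i + int k"
  proof (cases "l = j")
    case False
    with l have "edge \<mu> (l - 1) \<le> edge \<mu> j"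
      by (intro edge_le part) simp
    with False l lower show ?thesis by (simp add: edge_extended)
  qed (simp add: edge_extended)
  then show "e \<in> {edge \<mu> i..<edge \<mu> i + int k}"
    using le edge_le[OF part l(2)] by simp
qed

lemma ht_extended: "ht \<mu> extended = int (i - j)"
proof -
  let ?d = "edge \<mu> i"
  have size: "skew_size \<mu> extended = k"
    by (simp add: skew_size_def csize_extended)
  have "edge \<mu> i < edge extended i"
    using k ji edge_less[OF part, of "i - 1" i] by (auto simp: edge_extended)
  then have first: "row_on \<mu> extended ?d = i"
    using k by (intro row_on_eq unique_row) auto
  have last: "row_on \<mu> extended (?d + int k - 1) = j"
    using k lower by (intro row_on_eq unique_row) (auto simp: edge_extended)
  show ?thesis
    unfolding ht_def Let_def size ribbon_from_unique[OF ribbon_from_extended k] first last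
    using ji by (simp add: of_nat_diff)
qed

lemma alt_extended:
  assumes "i < n"
  shows "alt n ((\<lambda>l. stair n l + Poly_Mapping.lookup \<mu> l)(i := stair n i + Poly_Mapping.lookup \<mu> i + k)) =
    (- 1) ^ nat (ht \<mu> extended) * alt n (\<lambda>l. stair n l + Poly_Mapping.lookup extended l)"
proof -
  let ?g = "\<lambda>l. stair n l + Poly_Mapping.lookup extended l"
  have "alt n ((\<lambda>l. stair n l + Poly_Mapping.lookup \<mu> l)(i := stair n i + Poly_Mapping.lookup \<mu> i + k)) =
      alt n (?g \<circ> cycle_down j i)"
    by (rule alt_cong) (simp add: stair_extended[OF assms])
  also have "\<dots> = of_int ((- 1) ^ (i - j)) * alt n ?g"
    using alt_compose[of "cycle_down j i" n ?g] cycle_down_permutes_sign[OF ji assms] by simp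
  finally show ?thesis by (simp add: ht_extended)
qed

end

section \<open>Summation over the starting rows of ribbons\<close>

lemma ex_ribbon_addition:
  assumes "is_partition \<mu>" "k > 0" "\<And>l. edge \<mu> l \<noteq> edge \<mu> i + int k"
  shows "\<exists>\<nu>. ribbon_from (edge \<mu> i) k \<mu> \<nu> \<and> csize \<nu> = csize \<mu> + k \<and>
    (\<forall>n>i. alt n ((\<lambda>l. stair n l + Poly_Mapping.lookup \<mu> l)(i := stair n i + Poly_Mapping.lookup \<mu> i + k)) =
      (- 1) ^ nat (ht \<mu> \<nu>) * alt n (\<lambda>l. stair n l + Poly_Mapping.lookup \<nu> l))"
proof -
  \<comment> \<open>The sorted position of the raised edge; the third assumption excludes a tie,
    which gives \<open>upper\<close> its strict inequality.\<close>
  define j where "j = (LEAST j. edge \<mu> j < edge \<mu> i + int k)"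
  have "ribbon_addition \<mu> k i j"
  proof
    show "j \<le> i" unfolding j_def by (rule Least_le) (use assms(2) in simp)
    show "edge \<mu> j < edge \<mu> i + int k" unfolding j_def by (rule LeastI[of _ i]) (use assms(2) in simp)
    show "edge \<mu> i + int k < edge \<mu> l" if "l < j" for l
      using not_less_Least[of l "\<lambda>j. edge \<mu> j < edge \<mu> i + int k"] that assms(3)[of l]
      unfolding j_def by linarith
  qed (use assms in auto)
  then interpret ribbon_addition \<mu> k i j .
  show ?thesis
    using ribbon_from_extended csize_extended alt_extended by blast
qed

text \<open>Rows whose raised exponent is not repeated correspond bijectively to the
  \<open>k\<close>-ribbons on \<open>\<mu>\<close>: the first diagonal of the ribbon recovers the
  row, and together with \<open>k\<close> it determines the shape.\<close>

lemma sum_alt_ribbons: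
  assumes k: "k > 0" and \<mu>: "\<mu> \<in> partitions n" and N: "n + k \<le> N"
  shows "(\<Sum>i<N. alt N ((\<lambda>l. stair N l + Poly_Mapping.lookup \<mu> l)(i := stair N i + Poly_Mapping.lookup \<mu> i + k))) =
    (\<Sum>\<nu> | \<nu> \<in> partitions (n + k) \<and> ribbon k \<mu> \<nu>.
      (- 1) ^ nat (ht \<mu> \<nu>) * alt N (\<lambda>l. stair N l + Poly_Mapping.lookup \<nu> l))"
    (is "sum ?f _ = sum ?g ?R")
proof -
  have part: "is_partition \<mu>" and size: "csize \<mu> = n" using \<mu> by (auto simp: partitions_def)
  define G where "G = {i. i < N \<and> (\<forall>l. edge \<mu> l \<noteq> edge \<mu> i + int k)}"
  have "?f i = 0" if i: "i \<in> {..<N} - G" for i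
  proof -
    from i obtain l where l: "edge \<mu> l = edge \<mu> i + int k" by (auto simp: G_def)
    then have li: "l < i" using edge_le[OF part, of i l] k by (cases "l < i") auto
    with l i show ?thesis
      by (intro alt_eq_0[of i N l]) (auto simp: edge_def stair_def)
  qed
  then have "sum ?f {..<N} = sum ?f G"
    by (intro sum.mono_neutral_right) (auto simp: G_def)
  have "\<exists>\<nu>. \<forall>i\<in>G. ribbon_from (edge \<mu> i) k \<mu> (\<nu> i) \<and> csize (\<nu> i) = csize \<mu> + k \<and> ?f i = ?g (\<nu> i)"
  proof (intro bchoice ballI)
    fix i assume "i \<in> G"
    then have "i < N" "\<And>l. edge \<mu> l \<noteq> edge \<mu> i + int k" by (auto simp: G_def)
    then show "\<exists>\<nu>. ribbon_from (edge \<mu> i) k \<mu> \<nu> \<and> csize \<nu> = csize \<mu> + k \<and> ?f i = ?g \<nu>"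
      using ex_ribbon_addition[OF part k, of i] by blast
  qed
  then obtain \<nu> where \<nu>: "\<And>i. i \<in> G \<Longrightarrow> ribbon_from (edge \<mu> i) k \<mu> (\<nu> i)"
      "\<And>i. i \<in> G \<Longrightarrow> csize (\<nu> i) = csize \<mu> + k" "\<And>i. i \<in> G \<Longrightarrow> ?f i = ?g (\<nu> i)"
    by blast
  have "bij_betw \<nu> G ?R"
  proof (rule bij_betwI')
    fix i i' assume G: "i \<in> G" "i' \<in> G"
    show "\<nu> i = \<nu> i' \<longleftrightarrow> i = i'"
    proof
      assume "\<nu> i = \<nu> i'"
      then have "edge \<mu> i = edge \<mu> i'"
        using ribbon_from_unique[OF \<nu>(1)[OF G(1)] k] ribbon_from_unique[OF \<nu>(1)[OF G(2)] k] by simp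
      then show "i = i'"
        using edge_less[OF part, of i i'] edge_less[OF part, of i' i]
        by (cases i i' rule: linorder_cases) auto
    qed simp
  next
    fix i assume G: "i \<in> G"
    have "is_partition (\<nu> i)"
      using \<nu>(1)[OF G] by (simp add: ribbon_from_def skew_shape_def)
    then show "\<nu> i \<in> ?R"
      using \<nu>(1,2)[OF G] k size by (auto simp: partitions_def ribbon_def)
  next
    fix \<nu>' assume "\<nu>' \<in> ?R"
    then obtain d where \<nu>': "\<nu>' \<in> partitions (n + k)" "ribbon_from d k \<mu> \<nu>'"
      by (auto simp: ribbon_def)
    obtain i where i: "d = edge \<mu> i" "edge \<mu> i < edge \<nu>' i" "\<And>l. edge \<mu> l \<noteq> edge \<mu> i + int k"
      using ribbon_from_start[OF \<nu>'(2) k] by blast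
    \<comment> \<open>The starting row contains a square of a partition of \<open>n + k\<close>, so
      its index is below \<open>n + k \<le> N\<close> and the row occurs in the sum.\<close>
    have "Poly_Mapping.lookup \<nu>' i \<noteq> 0" using i(2) by (simp add: edge_def)
    then have "i < n + k"
      using vecs_lookup_eq_0[OF partitions_subset_vecs[OF \<nu>'(1)], of i] by (cases "i < n + k") auto
    then have "i \<in> G" using N i(3) by (simp add: G_def)
    moreover from this have "\<nu>' = \<nu> i"
      using \<nu>'(2) i(1) \<nu>(1) by (auto intro: ribbon_from_inject)
    ultimately show "\<exists>i\<in>G. \<nu>' = \<nu> i" by blast
  qed
  then have "sum ?g ?R = (\<Sum>i\<in>G. ?g (\<nu> i))"
    by (rule sum.reindex_bij_betw[symmetric])
  also have "\<dots> = sum ?f G"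
    by (rule sum.cong) (simp_all add: \<nu>(3))
  finally show ?thesis
    using \<open>sum ?f {..<N} = sum ?f G\<close> by simp
qed

lemma truncate_power_sum:
  assumes "k > 0"
  shows "truncate_vars n (power_sum k) = (\<Sum>i<n. X i ^ k)"
proof (rule mseries_eqI)
  fix m :: composition
  have pow: "var i ^ k = Poly_Mapping.single (Poly_Mapping.single i k) 1" for i
  proof (induction k)
    case (Suc k)
    then show ?case
      by (simp add: var_def mult_single flip: single_add)
  qed simp
  \<comment> \<open>Because \<open>k > 0\<close>, the monomial of \<open>var i ^ k\<close> involves
    \<open>X i\<close> and lies outside \<open>vecs n\<close> for \<open>i \<ge> n\<close>.\<close>
  have zero: "Poly_Mapping.lookup (var i ^ k) m = 0" if "m \<in> vecs n" "n \<le> i" for i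
    using that assms by (auto simp: pow lookup_single when_def vecs_def)
  have zero': "Poly_Mapping.lookup (var i ^ k) m = 0" if "m \<notin> vecs n" "i < n" for i
    using that by (auto simp: pow lookup_single when_def vecs_def split: if_splits)
  have rhs: "mcoeff (\<Sum>i<n. X i ^ k) m = (\<Sum>i<n. Poly_Mapping.lookup (var i ^ k) m)"
    by (simp only: mcoeff_sum X_def series_of_poly_power [symmetric] mcoeff_poly)
  show "mcoeff (truncate_vars n (power_sum k)) m = mcoeff (\<Sum>i<n. X i ^ k) m"
  proof (cases "m \<in> vecs n")
    case True
    have "i < n" if "Poly_Mapping.lookup (var i ^ k) m \<noteq> 0" for i
      using that zero[OF True, of i] by (cases "i < n") auto
    then have "{i. Poly_Mapping.lookup (var i ^ k) m \<noteq> 0} \<subseteq> {..<n}" by auto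
    from Sum_any.expand_superset[OF finite_lessThan this] show ?thesis
      unfolding rhs by (simp only: power_sum_def mcoeff_truncate Abs_mseries_coeff True if_True)
  next
    case False
    then have "(\<Sum>i<n. Poly_Mapping.lookup (var i ^ k) m) = 0"
      by (intro sum.neutral) (simp add: zero')
    with False show ?thesis unfolding rhs by simp
  qed
qed

theorem proposition2p4:
  fixes k n :: nat and \<mu> :: composition
  assumes "k > 0" and "\<mu> \<in> partitions n"
  shows "power_sum k * schur \<mu> =
    (\<Sum>\<nu>\<in>partitions (n + k).
       of_bool (ribbon k \<mu> \<nu>) * (- 1) ^ nat (ht \<mu> \<nu>) * schur \<nu>)"
proof (rule truncations_determine)
  \<comment> \<open>From here on \<open>\<mu>\<close> and all partitions of \<open>n + k\<close> lie
    in \<open>vecs N\<close>, so each of their Schur polynomials is a genuine quotient of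
    alternants.\<close>
  fix N assume N: "n + k \<le> N"
  let ?s = "\<lambda>\<nu>. series_of_poly (schur_poly N \<nu>)"
  let ?a = "alt N (stair N)"
  let ?R = "{\<nu> \<in> partitions (n + k). ribbon k \<mu> \<nu>}"
  have part: "is_partition \<mu>" and \<mu>: "\<mu> \<in> vecs N"
    using assms(2) vecs_mono[OF partitions_subset_vecs[OF assms(2)], of N] N
    by (auto simp: partitions_def)
  have R: "is_partition \<nu>" "\<nu> \<in> vecs N" if "\<nu> \<in> ?R" for \<nu>
    using that vecs_mono[OF partitions_subset_vecs N] by (auto simp: partitions_def)
  have lhs: "truncate_vars N (power_sum k * schur \<mu>) = (\<Sum>i<N. X i ^ k) * ?s \<mu>"
    by (simp only: truncate.hom_mult truncate_power_sum[OF assms(1)] truncate_schur[OF part])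
  have "(\<Sum>\<nu>\<in>partitions (n + k). of_bool (ribbon k \<mu> \<nu>) * (- 1) ^ nat (ht \<mu> \<nu>) * schur \<nu>) =
      (\<Sum>\<nu>\<in>?R. (- 1) ^ nat (ht \<mu> \<nu>) * schur \<nu>)"
  proof (rule sum.mono_neutral_cong_right)
    show "finite (partitions (n + k))" by (rule finite_partitions)
  qed simp_all
  moreover have "truncate_vars N (\<Sum>\<nu>\<in>?R. (- 1) ^ nat (ht \<mu> \<nu>) * schur \<nu>) =
      (\<Sum>\<nu>\<in>?R. (- 1) ^ nat (ht \<mu> \<nu>) * ?s \<nu>)"
    unfolding truncate.hom_sum truncate.hom_mult truncate.hom_power truncate.hom_uminus truncate.hom_1
    by (rule sum.cong) (simp_all only: truncate_schur[OF R(1)])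
  ultimately have rhs: "truncate_vars N (\<Sum>\<nu>\<in>partitions (n + k).
        of_bool (ribbon k \<mu> \<nu>) * (- 1) ^ nat (ht \<mu> \<nu>) * schur \<nu>) =
      (\<Sum>\<nu>\<in>?R. (- 1) ^ nat (ht \<mu> \<nu>) * ?s \<nu>)"
    by (simp only:)
  have "(\<Sum>i<N. X i ^ k) * ?s \<mu> * ?a = (\<Sum>\<nu>\<in>?R. (- 1) ^ nat (ht \<mu> \<nu>) * ?s \<nu>) * ?a"
  proof -
    have "(\<Sum>i<N. X i ^ k) * ?s \<mu> * ?a =
        (\<Sum>i<N. X i ^ k) * alt N (\<lambda>l. stair N l + Poly_Mapping.lookup \<mu> l)"
      by (simp only: mult.assoc schur_poly_mult_alt(1)[OF part \<mu>])
    also have "\<dots> = (\<Sum>\<nu>\<in>?R. (- 1) ^ nat (ht \<mu> \<nu>) * alt N (\<lambda>l. stair N l + Poly_Mapping.lookup \<nu> l))"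
      unfolding power_sum_mult_alt by (rule sum_alt_ribbons[OF assms N])
    also have "\<dots> = (\<Sum>\<nu>\<in>?R. (- 1) ^ nat (ht \<mu> \<nu>) * ?s \<nu> * ?a)"
      by (rule sum.cong) (simp_all only: mult.assoc schur_poly_mult_alt(1)[OF R])
    finally show ?thesis by (simp only: sum_distrib_right)
  qed
  moreover have "(\<Sum>i<N. X i ^ k) * ?s \<mu> \<in> polys"
    by (intro polys_mult polys_sum)
      (simp_all only: X_def series_of_poly_power [symmetric] series_of_poly_in_polys)
  moreover have "(- 1) ^ h \<in> polys" for h
    by (induction h) (simp_all add: polys_uminus)
  then have "(\<Sum>\<nu>\<in>?R. (- 1) ^ nat (ht \<mu> \<nu>) * ?s \<nu>) \<in> polys"
    by (intro polys_sum polys_mult series_of_poly_in_polys)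
  ultimately have "(\<Sum>i<N. X i ^ k) * ?s \<mu> = (\<Sum>\<nu>\<in>?R. (- 1) ^ nat (ht \<mu> \<nu>) * ?s \<nu>)"
    using polys_cancel[OF _ _ alt_in_polys alt_stair_nonzero[of N]] by blast
  then show "truncate_vars N (power_sum k * schur \<mu>) =
      truncate_vars N (\<Sum>\<nu>\<in>partitions (n + k).
        of_bool (ribbon k \<mu> \<nu>) * (- 1) ^ nat (ht \<mu> \<nu>) * schur \<nu>)"
    by (simp only: lhs rhs)
qed

end
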